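(* Let $(\mathcal{A},\varepsilon)$ be a full-dimensional signed support in $\mathbb{R}^n$ of codimension $2$ such that either $\#\mathcal{A}_-=1$, or there is an $n$-simplex $P\subseteq\mathbb{R}^n$ with $\mathcal{A}_+\subseteq P$, $\mathcal{A}_-\subseteq P^-$ and $\mathcal{A}\cap\operatorname{int}(P\cup P^-)\neq\emptyset$. If for each (nonempty) proper face $F\subsetneq\operatorname{Conv}(\mathcal{A})$ the restricted signed support $(\mathcal{A}_F,\varepsilon_F)$ has a non-trivial separating hyperplane, then for each smooth hypersurface $Z(f_c)$ with $c\in\mathbb{R}^{\mathcal{A}}_\varepsilon$ there exists $h\in\mathbb{R}^{\mathcal{A}}$ such that the signed tropical hypersurface $\operatorname{Trop}_\varepsilon(\mathcal{A},h)$ and $Z(f_c)$ have the same isotopy type.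
   Context: A signed support $(\mathcal{A},\varepsilon)$ in $\mathbb{R}^n$ consists of a finite set $\mathcal{A}=\{\alpha_1,\dots,\alpha_{n+k+1}\}\subseteq\mathbb{R}^n$ of (distinct) exponent vectors and a sign distribution $\varepsilon\in\{\pm1\}^{n+k+1}$; it is full-dimensional if $\dim\operatorname{Conv}(\mathcal{A})=n$, and then its codimension is $k$ (so codimension $2$ means $\#\mathcal{A}=n+3$). Put $\mathcal{A}_+=\{\alpha_i:\varepsilon_i=1\}$, $\mathcal{A}_-=\{\alpha_i:\varepsilon_i=-1\}$ and $\mathbb{R}^{\mathcal{A}}_\varepsilon=\{c\in\mathbb{R}^{n+k+1}:\operatorname{sign}(c)=\varepsilon\}$. For $c\in\mathbb{R}^{\mathcal{A}}_\varepsilon$ let $f_c(x)=\sum_i c_i e^{\alpha_i\cdot x}$ on $\mathbb{R}^n$ and $Z(f_c)=\{x\in\mathbb{R}^n:f_c(x)=0\}$; $Z(f_c)$ is smooth if there is no $x\in\mathbb{R}^n$ at which $f_c$ and all its first partial derivatives vanish. For a face $F$ of $\operatorname{Conv}(\mathcal{A})$, $\mathcal{A}_F=\mathcal{A}\cap F$ and $\varepsilon_F=(\varepsilon_i)_{\alpha_i\in\mathcal{A}_F}$. For an $n$-simplex $P$ (convex hull of $n+1$ affinely independent points) with vertices $\mu_0,\dots,\mu_n$, put $P^{-,k}=\mu_k+\operatorname{Cone}(\mu_k-\mu_0,\dots,\mu_k-\mu_n)$ ($\operatorname{Cone}$ = nonnegative linear combinations) and $P^-=P^{-,0}\cup\dots\cup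 P^{-,n}$. For $v\in\mathbb{R}^n\setminus\{0\}$, $a\in\mathbb{R}$ let $\mathcal{H}_{v,a}=\{\mu:v\cdot\mu=a\}$, $\mathcal{H}^+_{v,a}=\{\mu:v\cdot\mu\ge a\}$, $\mathcal{H}^-_{v,a}=\{\mu:v\cdot\mu\le a\}$. $\mathcal{H}_{v,a}$ is a separating hyperplane of a signed support if its positive exponent vectors lie in $\mathcal{H}^+_{v,a}$ and its negative ones lie in $\mathcal{H}^-_{v,a}$; it is non-trivial if at least one of $\operatorname{int}(\mathcal{H}^+_{v,a})$, $\operatorname{int}(\mathcal{H}^-_{v,a})$ contains a point of the support. For $h\in\mathbb{R}^{\mathcal{A}}\cong\mathbb{R}^{n+k+1}$, the signed tropical hypersurface $\operatorname{Trop}_\varepsilon(\mathcal{A},h)$ is the set of $v\in\mathbb{R}^n$ such that $\max_{i}(v\cdot\alpha_i+h_i)$ is attained both for some $\alpha\in\mathcal{A}_+$ and for some $\alpha'\in\mathcal{A}_-$. Two subsets $Z_0,Z_1\subseteq\mathbb{R}^n$ have the same isotopy type if there is a continuous map $H:[0,1]\times\mathbb{R}^n\to\mathbb{R}^n$ such that $H(t,\cdot)$ is a homeomorphism for all $t$, $H(0,\cdot)$ is the identity, and $H(1,Z_0)=Z_1$. *)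

theory Defs
  imports "HOL-Analysis.Analysis"
begin

(* A sign distribution, a coefficient vector and a height vector on the support A are functions
   on the ambient space; only their values on A are ever used. *)
definition signed_support :: "(real^'n) set \<Rightarrow> (real^'n \<Rightarrow> real) \<Rightarrow> bool" where
  "signed_support A \<epsilon> \<longleftrightarrow> finite A \<and> (\<forall>\<alpha>\<in>A. \<epsilon> \<alpha> \<in> {1, -1})"

definition full_dimensional :: "(real^'n) set \<Rightarrow> bool" where
  "full_dimensional A \<longleftrightarrow> aff_dim (convex hull A) = int CARD('n)"

(* Codimension k, for full-dimensional A: #A = n + k + 1. *)
definition has_codimension :: "(real^'n) set \<Rightarrow> nat \<Rightarrow> bool" where
  "has_codimension A k \<longleftrightarrow> card A = CARD('n) + k + 1"

definition pos_part :: "(real^'n) set \<Rightarrow> (real^'n \<Rightarrow> real) \<Rightarrow> (real^'n) set" where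
  "pos_part A \<epsilon> = {\<alpha> \<in> A. \<epsilon> \<alpha> = 1}"

definition neg_part :: "(real^'n) set \<Rightarrow> (real^'n \<Rightarrow> real) \<Rightarrow> (real^'n) set" where
  "neg_part A \<epsilon> = {\<alpha> \<in> A. \<epsilon> \<alpha> = -1}"

definition coeffs_with_signs :: "(real^'n) set \<Rightarrow> (real^'n \<Rightarrow> real) \<Rightarrow> (real^'n \<Rightarrow> real) set" where
  "coeffs_with_signs A \<epsilon> = {c. \<forall>\<alpha>\<in>A. sgn (c \<alpha>) = \<epsilon> \<alpha>}"

definition exp_sum :: "(real^'n) set \<Rightarrow> (real^'n \<Rightarrow> real) \<Rightarrow> real^'n \<Rightarrow> real" where
  "exp_sum A c x = (\<Sum>\<alpha>\<in>A. c \<alpha> * exp (\<alpha> \<bullet> x))"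

definition zero_set :: "(real^'n \<Rightarrow> real) \<Rightarrow> (real^'n) set" where
  "zero_set f = {x. f x = 0}"

(* f is meant to be differentiable; the inner condition says that the i-th partial derivative
   of f vanishes at x. *)
definition smooth_zero_set :: "(real^'n \<Rightarrow> real) \<Rightarrow> bool" where
  "smooth_zero_set f \<longleftrightarrow>
     \<not> (\<exists>x. f x = 0 \<and>
          (\<forall>i. ((\<lambda>t. f (x + t *\<^sub>R axis i 1)) has_real_derivative 0) (at 0)))"

(* The cone at a vertex m that is opposite to the simplex with vertex set V. *)
definition opposite_cone :: "(real^'n) set \<Rightarrow> real^'n \<Rightarrow> (real^'n) set" where
  "opposite_cone V m =
     {m + (\<Sum>\<mu>\<in>V. r \<mu> *\<^sub>R (m - \<mu>)) | r. \<forall>\<mu>\<in>V. (0::real) \<le> r \<mu>}"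

(* The set written P with superscript minus, for a simplex P; the extreme points of a simplex
   are its vertices. *)
definition simplex_opposite :: "(real^'n) set \<Rightarrow> (real^'n) set" where
  "simplex_opposite P =
     (\<Union>m\<in>{m. m extreme_point_of P}. opposite_cone {\<mu>. \<mu> extreme_point_of P} m)"

definition halfspace_ge :: "real^'n \<Rightarrow> real \<Rightarrow> (real^'n) set" where
  "halfspace_ge v a = {\<mu>. v \<bullet> \<mu> \<ge> a}"

definition halfspace_le :: "real^'n \<Rightarrow> real \<Rightarrow> (real^'n) set" where
  "halfspace_le v a = {\<mu>. v \<bullet> \<mu> \<le> a}"

(* The hyperplane {m. v \<bullet> m = a} is represented by the pair (v, a). *)
definition separating_hyperplane ::
    "(real^'n) set \<Rightarrow> (real^'n \<Rightarrow> real) \<Rightarrow> real^'n \<Rightarrow> real \<Rightarrow> bool" where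
  "separating_hyperplane A \<epsilon> v a \<longleftrightarrow>
     v \<noteq> 0 \<and> pos_part A \<epsilon> \<subseteq> halfspace_ge v a \<and> neg_part A \<epsilon> \<subseteq> halfspace_le v a"

definition nontrivial_separating_hyperplane ::
    "(real^'n) set \<Rightarrow> (real^'n \<Rightarrow> real) \<Rightarrow> real^'n \<Rightarrow> real \<Rightarrow> bool" where
  "nontrivial_separating_hyperplane A \<epsilon> v a \<longleftrightarrow>
     separating_hyperplane A \<epsilon> v a \<and>
     (A \<inter> interior (halfspace_ge v a) \<noteq> {} \<or> A \<inter> interior (halfspace_le v a) \<noteq> {})"

definition signed_trop ::
    "(real^'n) set \<Rightarrow> (real^'n \<Rightarrow> real) \<Rightarrow> (real^'n \<Rightarrow> real) \<Rightarrow> (real^'n) set" where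
  "signed_trop A \<epsilon> h =
     {v. (\<exists>\<alpha>\<in>pos_part A \<epsilon>. v \<bullet> \<alpha> + h \<alpha> = (MAX \<beta>\<in>A. v \<bullet> \<beta> + h \<beta>)) \<and>
         (\<exists>\<alpha>\<in>neg_part A \<epsilon>. v \<bullet> \<alpha> + h \<alpha> = (MAX \<beta>\<in>A. v \<bullet> \<beta> + h \<beta>))}"

definition same_isotopy_type :: "(real^'n) set \<Rightarrow> (real^'n) set \<Rightarrow> bool" where
  "same_isotopy_type Z0 Z1 \<longleftrightarrow>
     (\<exists>H :: real \<times> (real^'n) \<Rightarrow> real^'n.
        continuous_on ({0..1} \<times> UNIV) H \<and>
        (\<forall>t\<in>{0..1}. \<exists>g. homeomorphism UNIV UNIV (\<lambda>x. H (t, x)) g) \<and>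
        (\<forall>x. H (0, x) = x) \<and>
        (\<lambda>x. H (1, x)) ` Z0 = Z1)"

end

theory Submission
  imports Defs
begin

text \<open>
  Write the exponential sum as \<open>f\<^sub>+ - f\<^sub>-\<close>, where \<open>f\<^sub>+\<close> and \<open>f\<^sub>-\<close> collect the terms with positive and negative
  coefficients, and let \<open>\<Psi> = ln f\<^sub>- - ln f\<^sub>+\<close>. The hypersurface is the level set of \<open>\<Psi>\<close> at \<open>0\<close>. The difference
  \<open>S\<close> of the support functions of the negative and the positive exponents is the piecewise linear
  counterpart of \<open>\<Psi>\<close>, and its level set at \<open>T\<close> is the signed tropical hypersurface for the height \<open>T\<close>
  on the positive and \<open>0\<close> on the negative exponents. The proof joins the two hypersurfaces through
  the level set of \<open>\<Psi>\<close> at a large \<open>T\<close>.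

  The hypothesis on the position of the exponents gives a domination property: two probability
  measures on the positive and on the negative exponents with the same barycenter are ordered
  when integrated against exponentials (\<open>exp_dominated_simplex\<close>, \<open>exp_dominated_singleton\<close>; for a single
  negative exponent the signs are exchanged first). For a simplex with vertices \<open>\<mu>\<^sub>i\<close> the reason is
  that \<open>f = f\<^sub>+ - f\<^sub>-\<close> is concave in the coordinates \<open>exp (\<mu>\<^sub>i \<bullet> x)\<close>. Consequently every critical
  point of \<open>\<Psi>\<close> is a global minimum (\<open>critical_point_minimizes_log_ratio\<close>). So, as soon as \<open>f\<close> is positive
  somewhere, no level of \<open>\<Psi>\<close> at or above \<open>0\<close> is critical.

  The hypothesis on the faces excludes critical points at infinity: along a sequence that escapes,
  the normalized weights of the exponents concentrate on a proper face, and a nontrivial separating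
  hyperplane of this face keeps the gradient of \<open>\<Psi>\<close> away from zero. Hence the gradient is bounded below on
  the whole band \<open>0 \<le> \<Psi> \<le> T\<close> (\<open>log_ratio_grad_bounded_below\<close>), and all levels in the band are isotopic
  (\<open>levels_isotopic\<close>). The isotopy consists of small moves along the gradient, each a
  Lipschitz perturbation of the identity.

  For large \<open>T\<close>, the level sets of \<open>\<Psi>\<close> and of \<open>S\<close> at \<open>T\<close> both meet the rays on which \<open>S\<close> is positive exactly
  once, and meet no other ray. A radial stretching carries one to the other
  (\<open>high_level_isotopic_to_support_level\<close>).

  If \<open>f\<close> takes no positive value, smoothness makes it negative everywhere. Then \<open>S\<close> is nonnegative, and
  raising the negative exponents instead gives an empty tropical hypersurface.
\<close>

section \<open>Isotopies\<close>

lemma same_isotopy_type_refl: "same_isotopy_type Z Z"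
proof -
  have "continuous_on ({0..1} \<times> UNIV) (snd :: real \<times> (real^'n) \<Rightarrow> real^'n)"
    by (intro continuous_intros)
  moreover have "homeomorphism UNIV UNIV (\<lambda>x::real^'n. snd (t::real, x)) id" for t
    by (simp add: homeomorphism_def)
  ultimately show ?thesis
    unfolding same_isotopy_type_def
    by (intro exI[of _ snd]) auto
qed

text \<open>
  Run the isotopy backwards and precompose with the inverse of its final map. The only inverse
  that occurs is this one, so continuity in both variables is inherited.
\<close>
lemma same_isotopy_type_sym:
  fixes Z0 Z1 :: "(real^'n) set"
  assumes "same_isotopy_type Z0 Z1"
  shows "same_isotopy_type Z1 Z0"
proof -
  obtain H :: "real \<times> (real^'n) \<Rightarrow> real^'n"
    where cont: "continuous_on ({0..1} \<times> UNIV) H"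
    and homeo: "\<And>t. t \<in> {0..1} \<Longrightarrow> \<exists>g. homeomorphism UNIV UNIV (\<lambda>x. H (t, x)) g"
    and start: "\<And>x. H (0, x) = x" and img: "(\<lambda>x. H (1, x)) ` Z0 = Z1"
    using assms unfolding same_isotopy_type_def by blast
  obtain g where g: "homeomorphism UNIV UNIV (\<lambda>x. H (1, x)) g" using homeo[of 1] by auto
  have g_cont: "continuous_on UNIV g" and g_inv: "\<And>x. g (H (1, x)) = x"
    using g by (auto simp: homeomorphism_def)
  define K where "K = (\<lambda>(t, x). H (1 - t, g x))"
  have "continuous_on ({0..1} \<times> UNIV) (H \<circ> (\<lambda>(t, x). (1 - t, g x)))"
    by (intro continuous_on_compose continuous_on_subset[OF cont])
       (auto simp: split_def intro!: continuous_intros continuous_on_compose2[OF g_cont])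
  then have "continuous_on ({0..1} \<times> UNIV) K" by (simp add: K_def o_def split_def)
  moreover have "\<exists>k. homeomorphism UNIV UNIV (\<lambda>x. K (t, x)) k" if t: "t \<in> {0..1}" for t
  proof -
    obtain g' where g': "homeomorphism UNIV UNIV (\<lambda>x. H (1 - t, x)) g'"
      using homeo[of "1 - t"] t by auto
    have "homeomorphism UNIV UNIV ((\<lambda>x. H (1 - t, x)) \<circ> g) ((\<lambda>x. H (1, x)) \<circ> g')"
      using homeomorphism_compose[OF _ g'] g homeomorphism_sym by blast
    then show ?thesis by (auto simp: K_def o_def)
  qed
  moreover have "K (0, x) = x" for x using g by (simp add: K_def homeomorphism_def)
  moreover have "(\<lambda>x. K (1, x)) ` Z1 = Z0"
    by (auto simp: K_def start g_inv img[symmetric] image_image)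
  ultimately show ?thesis unfolding same_isotopy_type_def by blast
qed

text \<open>
  Composing two isotopies at equal times avoids concatenating them in time.
\<close>
lemma same_isotopy_type_trans:
  fixes Z0 Z1 Z2 :: "(real^'n) set"
  assumes "same_isotopy_type Z0 Z1" and "same_isotopy_type Z1 Z2"
  shows "same_isotopy_type Z0 Z2"
proof -
  obtain H :: "real \<times> (real^'n) \<Rightarrow> real^'n"
    where cont: "continuous_on ({0..1} \<times> UNIV) H"
    and homeo: "\<And>t. t \<in> {0..1} \<Longrightarrow> \<exists>g. homeomorphism UNIV UNIV (\<lambda>x. H (t, x)) g"
    and start: "\<And>x. H (0, x) = x" and img: "(\<lambda>x. H (1, x)) ` Z0 = Z1"
    using assms(1) unfolding same_isotopy_type_def by blast
  obtain H' :: "real \<times> (real^'n) \<Rightarrow> real^'n"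
    where cont': "continuous_on ({0..1} \<times> UNIV) H'"
    and homeo': "\<And>t. t \<in> {0..1} \<Longrightarrow> \<exists>g. homeomorphism UNIV UNIV (\<lambda>x. H' (t, x)) g"
    and start': "\<And>x. H' (0, x) = x" and img': "(\<lambda>x. H' (1, x)) ` Z1 = Z2"
    using assms(2) unfolding same_isotopy_type_def by blast
  define K where "K = (\<lambda>(t, x). H' (t, H (t, x)))"
  have "continuous_on ({0..1} \<times> UNIV) (H' \<circ> (\<lambda>p. (fst p, H p)))"
    by (intro continuous_on_compose continuous_on_subset[OF cont'] continuous_intros cont) auto
  then have "continuous_on ({0..1} \<times> UNIV) K" by (simp add: K_def o_def split_def)
  moreover have "\<exists>k. homeomorphism UNIV UNIV (\<lambda>x. K (t, x)) k" if t: "t \<in> {0..1}" for t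
  proof -
    obtain g g' where "homeomorphism UNIV UNIV (\<lambda>x. H (t, x)) g"
      "homeomorphism UNIV UNIV (\<lambda>x. H' (t, x)) g'"
      using homeo[OF t] homeo'[OF t] by auto
    from homeomorphism_compose[OF this] show ?thesis by (auto simp: K_def o_def)
  qed
  moreover have "K (0, x) = x" for x by (simp add: K_def start start')
  moreover have "(\<lambda>x. K (1, x)) ` Z0 = Z2"
    by (simp add: K_def img'[symmetric] img[symmetric] image_image)
  ultimately show ?thesis unfolding same_isotopy_type_def by blast
qed

text \<open>
  Surjectivity is the contraction principle applied to \<open>x \<mapsto> y - \<phi> x\<close>, and continuity of the
  inverse comes from invariance of domain.
\<close>
lemma homeomorphism_lipschitz_perturbation:
  fixes \<phi> :: "'a::euclidean_space \<Rightarrow> 'a"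
  assumes lip: "\<And>x y. norm (\<phi> x - \<phi> y) \<le> K * norm (x - y)" and "0 \<le> K" "K < 1"
  shows "\<exists>g. homeomorphism UNIV UNIV (\<lambda>x. x + \<phi> x) g"
proof -
  have "continuous_on UNIV \<phi>"
    using lip \<open>0 \<le> K\<close> by (intro lipschitz_on_continuous_on[of K] lipschitz_onI) (auto simp: dist_norm)
  then have cont: "continuous_on UNIV (\<lambda>x. x + \<phi> x)" by (intro continuous_intros)
  have inj: "inj (\<lambda>x. x + \<phi> x)"
  proof (rule injI)
    fix x y assume "x + \<phi> x = y + \<phi> y"
    then have "x - y = - (\<phi> x - \<phi> y)" by (simp add: algebra_simps)
    then have "norm (x - y) \<le> K * norm (x - y)" by (metis lip norm_minus_cancel)
    then have "(1 - K) * norm (x - y) \<le> 0" by (simp add: algebra_simps)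
    then show "x = y" using \<open>K < 1\<close> by (simp add: mult_le_0_iff)
  qed
  have "\<exists>x. y = x + \<phi> x" for y
  proof -
    have "\<forall>x z. dist (y - \<phi> x) (y - \<phi> z) \<le> K * dist x z"
      using lip by (simp add: dist_norm norm_minus_commute)
    from banach_fix_type[OF \<open>0 \<le> K\<close> \<open>K < 1\<close> this] have "\<exists>x. y - \<phi> x = x" by blast
    then show ?thesis by (metis diff_add_cancel)
  qed
  then have "range (\<lambda>x. x + \<phi> x) = UNIV" by auto
  then show ?thesis
    using invariance_of_domain_homeomorphism[OF open_UNIV cont _ inj] by auto
qed

text \<open>
  The basic step of the deformation of level sets: a chain of such perturbations takes the place of
  the flow of a vector field.
\<close>
lemma isotopy_lipschitz_perturbation:
  fixes \<phi> :: "real^'n \<Rightarrow> real^'n"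
  assumes lip: "\<And>x y. norm (\<phi> x - \<phi> y) \<le> K * norm (x - y)" and K: "0 \<le> K" "K < 1"
    and img: "(\<lambda>x. x + \<phi> x) ` Z0 = Z1"
  shows "same_isotopy_type Z0 Z1"
proof -
  define H where "H = (\<lambda>(t::real, x). x + t *\<^sub>R \<phi> x)"
  have cont: "continuous_on UNIV \<phi>"
    using lip K by (intro lipschitz_on_continuous_on[of K] lipschitz_onI) (auto simp: dist_norm)
  have "continuous_on ({0..1} \<times> UNIV) H"
    unfolding H_def split_def by (intro continuous_intros continuous_on_compose2[OF cont]) auto
  moreover have "\<exists>g. homeomorphism UNIV UNIV (\<lambda>x. H (t, x)) g" if t: "t \<in> {0..1}" for t
  proof -
    have "norm (t *\<^sub>R \<phi> x - t *\<^sub>R \<phi> y) \<le> K * norm (x - y)" for x y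
    proof -
      have "norm (t *\<^sub>R \<phi> x - t *\<^sub>R \<phi> y) = t * norm (\<phi> x - \<phi> y)"
        using t by (simp flip: scaleR_diff_right)
      also have "\<dots> \<le> 1 * norm (\<phi> x - \<phi> y)" using t by (intro mult_right_mono) auto
      finally show ?thesis using lip[of x y] by simp
    qed
    from homeomorphism_lipschitz_perturbation[OF this K] show ?thesis by (simp add: H_def)
  qed
  ultimately show ?thesis
    using img unfolding same_isotopy_type_def by (intro exI[of _ H]) (auto simp: H_def)
qed

section \<open>Level sets of a function with gradient bounded away from zero\<close>

context
  fixes \<Psi> :: "real^'n \<Rightarrow> real" and g :: "real^'n \<Rightarrow> real^'n" and M L :: real
  assumes deriv: "\<And>x. (\<Psi> has_derivative (\<lambda>h. g x \<bullet> h)) (at x)"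
    and bound: "\<And>x. norm (g x) \<le> M"
    and lip: "\<And>x y. norm (g x - g y) \<le> L * norm (x - y)"
    and L_pos: "0 < L"
begin

lemma gradient_bound_nonneg: "0 \<le> M"
  by (rule order_trans[OF norm_ge_zero bound[of 0]])

lemma line_deriv:
  "((\<lambda>t. \<Psi> (x + t *\<^sub>R v)) has_real_derivative g (x + t *\<^sub>R v) \<bullet> v) (at t)"
proof -
  have "((\<lambda>t. x + t *\<^sub>R v) has_derivative (\<lambda>h. h *\<^sub>R v)) (at t)"
    by (auto intro!: derivative_eq_intros)
  from has_derivative_compose[OF this deriv]
  show ?thesis by (simp add: has_field_derivative_def mult.commute[of _ "_ \<bullet> _"])
qed

lemma function_lipschitz: "\<bar>\<Psi> x - \<Psi> y\<bar> \<le> M * norm (x - y)"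
proof -
  have "norm (\<Psi> x - \<Psi> y) \<le> M * norm (x - y)"
  proof (rule differentiable_bound[of UNIV \<Psi> "\<lambda>x h. g x \<bullet> h"])
    show "onorm (\<lambda>h. g z \<bullet> h) \<le> M" for z
    proof (rule onorm_le)
      fix h
      show "norm (g z \<bullet> h) \<le> M * norm h"
        using Cauchy_Schwarz_ineq2[of "g z" h] mult_right_mono[OF bound[of z] norm_ge_zero[of h]]
        by simp
    qed
  qed (use deriv in auto)
  then show ?thesis by simp
qed

text \<open>
  The slope of \<open>\<Psi>\<close> along the line through \<open>x\<close> in direction \<open>g x\<close> is \<open>(norm (g x))\<^sup>2\<close> at \<open>x\<close> itself, and
  the Lipschitz bound on \<open>g\<close> lets it drop by at most one half on the parameter interval
  \<open>\<bar>t\<bar> \<le> 1 / (2 * L)\<close>, whatever the size of \<open>g x\<close>.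
\<close>
lemma line_ascent:
  assumes "\<bar>t\<bar> \<le> 1 / (2 * L)" "\<bar>u\<bar> \<le> 1 / (2 * L)" "t \<le> u" and \<delta>: "0 \<le> \<delta>" "\<delta> \<le> norm (g x)"
  shows "(u - t) * (\<delta>\<^sup>2 / 2) \<le> \<Psi> (x + u *\<^sub>R g x) - \<Psi> (x + t *\<^sub>R g x)"
proof (cases "t = u")
  case False
  then have "t < u" using assms by simp
  have slope: "\<delta>\<^sup>2 / 2 \<le> g (x + s *\<^sub>R g x) \<bullet> g x" if s: "\<bar>s\<bar> \<le> 1 / (2 * L)" for s
  proof -
    let ?G = "norm (g x)"
    have "norm (g (x + s *\<^sub>R g x) - g x) \<le> L * (\<bar>s\<bar> * ?G)"
      using lip[of "x + s *\<^sub>R g x" x] by simp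
    also have "\<dots> \<le> ?G / 2"
    proof -
      have "L * \<bar>s\<bar> \<le> 1 / 2" using s L_pos by (simp add: field_simps)
      from mult_right_mono[OF this norm_ge_zero[of "g x"]] show ?thesis by (simp add: algebra_simps)
    qed
    finally have "\<bar>(g (x + s *\<^sub>R g x) - g x) \<bullet> g x\<bar> \<le> ?G / 2 * ?G"
      using Cauchy_Schwarz_ineq2[of "g (x + s *\<^sub>R g x) - g x" "g x"]
      by (meson mult_right_mono norm_ge_zero order_trans)
    moreover have "g x \<bullet> g x = ?G * ?G" by (simp add: power2_norm_eq_inner[symmetric] power2_eq_square)
    ultimately have "?G * ?G / 2 \<le> g (x + s *\<^sub>R g x) \<bullet> g x"
      unfolding inner_diff_left by linarith
    moreover have "\<delta>\<^sup>2 \<le> ?G * ?G" using \<delta> by (simp add: power2_eq_square mult_mono)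
    ultimately show ?thesis by simp
  qed
  obtain z where z: "t < z" "z < u"
    and eq: "\<Psi> (x + u *\<^sub>R g x) - \<Psi> (x + t *\<^sub>R g x) = (u - t) * (g (x + z *\<^sub>R g x) \<bullet> g x)"
    using MVT2[OF \<open>t < u\<close>, of "\<lambda>t. \<Psi> (x + t *\<^sub>R g x)" "\<lambda>t. g (x + t *\<^sub>R g x) \<bullet> g x"] line_deriv by blast
  show ?thesis unfolding eq using z assms by (intro mult_left_mono slope) auto
qed simp

text \<open>
  The increment over parameter time \<open>t\<close> depends on the starting point with a Lipschitz constant
  proportional to \<open>t\<close>. This factor is what makes the moves below small perturbations of the identity.
\<close>
lemma line_increment_lipschitz:
  assumes t: "\<bar>t\<bar> \<le> 1 / (2 * L)"
  shows "\<bar>(\<Psi> (x + t *\<^sub>R g x) - \<Psi> x) - (\<Psi> (y + t *\<^sub>R g y) - \<Psi> y)\<bar>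
    \<le> 3 * L * M * norm (x - y) * \<bar>t\<bar>"
proof -
  define D where "D = (\<lambda>s. \<Psi> (x + s *\<^sub>R g x) - \<Psi> (y + s *\<^sub>R g y))"
  define D' where "D' = (\<lambda>s. g (x + s *\<^sub>R g x) \<bullet> g x - g (y + s *\<^sub>R g y) \<bullet> g y)"
  let ?n = "norm (x - y)"
  have "(D has_real_derivative D' s) (at s)" for s
    unfolding D_def D'_def by (intro DERIV_diff line_deriv)
  moreover have "\<bar>D' s\<bar> \<le> 3 * L * M * ?n" if s: "\<bar>s\<bar> \<le> 1 / (2 * L)" for s
  proof -
    let ?p = "g (x + s *\<^sub>R g x)" and ?q = "g (y + s *\<^sub>R g y)"
    have "norm (?p - ?q) \<le> L * norm ((x - y) + s *\<^sub>R (g x - g y))"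
      using lip[of "x + s *\<^sub>R g x" "y + s *\<^sub>R g y"] by (simp add: algebra_simps)
    also have "\<dots> \<le> L * (?n + \<bar>s\<bar> * (L * ?n))"
      using L_pos lip[of x y]
      by (intro mult_left_mono norm_triangle_le add_left_mono) (auto intro!: mult_left_mono)
    also have "\<dots> \<le> L * (2 * ?n)"
    proof -
      have "\<bar>s\<bar> * L \<le> 1" using s L_pos by (simp add: field_simps)
      from mult_right_mono[OF this norm_ge_zero[of "x - y"]] L_pos show ?thesis
        by (intro mult_left_mono) (auto simp: algebra_simps)
    qed
    finally have pq: "norm (?p - ?q) \<le> L * (2 * ?n)" .
    have "D' s = (?p - ?q) \<bullet> g x + ?q \<bullet> (g x - g y)" by (simp add: D'_def inner_diff_left inner_diff_right)
    also have "\<bar>\<dots>\<bar> \<le> norm (?p - ?q) * norm (g x) + norm ?q * norm (g x - g y)"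
      by (intro order_trans[OF abs_triangle_ineq] add_mono Cauchy_Schwarz_ineq2)
    also have "\<dots> \<le> (L * (2 * ?n)) * M + M * (L * ?n)"
      using pq bound[of x] bound[of "y + s *\<^sub>R g y"] lip[of x y] gradient_bound_nonneg L_pos
      by (intro add_mono mult_mono) auto
    finally show ?thesis by (simp add: algebra_simps)
  qed
  ultimately have "norm (D t - D 0) \<le> 3 * L * M * ?n * norm (t - 0)"
    by (intro field_differentiable_bound[of "{-1/(2*L)..1/(2*L)}" D D'])
      (use t L_pos in \<open>auto intro: DERIV_subset has_field_derivative_at_within\<close>)
  then show ?thesis by (simp add: D_def algebra_simps)
qed

text \<open>
  Move each point \<open>x\<close> by \<open>\<theta> x *\<^sub>R g x\<close>, where \<open>\<theta> x\<close> is chosen so that \<open>\<Psi>\<close> changes by exactly \<open>s' - s\<close> times a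
  bump function of the value \<open>\<Psi> x\<close>. The implicitly defined \<open>\<theta>\<close> has a Lipschitz constant of order
  \<open>\<bar>s' - s\<bar>\<close>, so for small \<open>\<bar>s' - s\<bar>\<close> the move is an isotopy that carries one level onto the other.
\<close>
lemma nearby_levels_isotopic:
  assumes \<delta>: "0 < \<delta>" and r: "0 < r" and band: "\<And>x. \<bar>\<Psi> x - s\<bar> \<le> r \<Longrightarrow> \<delta> \<le> norm (g x)"
  shows "\<exists>\<epsilon>>0. \<forall>s'. \<bar>s' - s\<bar> < \<epsilon> \<longrightarrow> same_isotopy_type {x. \<Psi> x = s} {x. \<Psi> x = s'}"
proof -
  define k where "k = 2 / \<delta>\<^sup>2"
  define K\<^sub>\<theta> where "K\<^sub>\<theta> = k * (M / r + 3 * L * M * k)"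
  define K where "K = K\<^sub>\<theta> * M + k * L"
  have k: "0 < k" using \<delta> by (simp add: k_def)
  have K: "0 \<le> K\<^sub>\<theta>" "0 \<le> K" using k r gradient_bound_nonneg L_pos by (auto simp: K_def K\<^sub>\<theta>_def)
  \<comment> \<open>\<open>K\<^sub>\<theta>\<close> and \<open>K\<close> are the Lipschitz constants of \<open>\<theta>\<close> and of the move, per unit of
    \<open>\<bar>s' - s\<bar>\<close>. The three bounds on \<open>\<bar>s' - s\<bar>\<close> make the target value reachable, keep
    \<open>u \<mapsto> u + (s' - s) * bump u\<close> injective, and make the move a contraction.\<close>
  define \<epsilon> where "\<epsilon> = min (min (\<delta>\<^sup>2 / (4 * L)) r) (1 / (K + 1))"
  have "0 < \<epsilon>" using \<delta> L_pos r K by (simp add: \<epsilon>_def)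
  moreover have "same_isotopy_type {x. \<Psi> x = s} {x. \<Psi> x = s'}" if s': "\<bar>s' - s\<bar> < \<epsilon>" for s'
  proof -
    define bump where "bump = (\<lambda>u. max 0 (1 - \<bar>u - s\<bar> / r))"
    define e where "e = (\<lambda>x. (s' - s) * bump (\<Psi> x))"
    have bump_lip: "\<bar>bump u - bump v\<bar> \<le> \<bar>u - v\<bar> / r" for u v
    proof -
      have "\<bar>max 0 (1 - p) - max 0 (1 - q)\<bar> \<le> \<bar>p - q\<bar>" for p q :: real by linarith
      then have "\<bar>bump u - bump v\<bar> \<le> \<bar>\<bar>u - s\<bar> / r - \<bar>v - s\<bar> / r\<bar>" by (simp add: bump_def)
      also have "\<dots> = \<bar>\<bar>u - s\<bar> - \<bar>v - s\<bar>\<bar> / r" using r by (simp add: diff_divide_distrib[symmetric])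
      also have "\<dots> \<le> \<bar>u - v\<bar> / r" using r by (intro divide_right_mono) auto
      finally show ?thesis .
    qed
    have bump_le: "0 \<le> bump u" "bump u \<le> 1" for u using r by (auto simp: bump_def)
    have e_lip: "\<bar>e x - e y\<bar> \<le> \<bar>s' - s\<bar> * (M / r) * norm (x - y)" for x y
    proof -
      have "\<bar>e x - e y\<bar> = \<bar>s' - s\<bar> * \<bar>bump (\<Psi> x) - bump (\<Psi> y)\<bar>"
        by (simp add: e_def abs_mult[symmetric] algebra_simps)
      also have "\<dots> \<le> \<bar>s' - s\<bar> * (M * norm (x - y) / r)"
        using bump_lip[of "\<Psi> x" "\<Psi> y"] divide_right_mono[OF function_lipschitz[of x y], of r] r
        by (intro mult_left_mono) auto
      finally show ?thesis by simp
    qed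
    have e_small: "\<bar>e x\<bar> \<le> \<bar>s' - s\<bar>" for x
      using mult_left_mono[OF bump_le(2)[of "\<Psi> x"] abs_ge_zero[of "s' - s"]] bump_le[of "\<Psi> x"]
      by (simp add: e_def abs_mult)
    have band': "\<delta> \<le> norm (g x)" if "bump (\<Psi> x) \<noteq> 0" for x
      using that r by (intro band) (auto simp: bump_def max_def field_simps split: if_splits)
    have ex: "\<exists>t. \<bar>t\<bar> \<le> 1 / (2 * L) \<and> \<Psi> (x + t *\<^sub>R g x) = \<Psi> x + e x" if "bump (\<Psi> x) \<noteq> 0" for x
    proof -
      let ?\<tau> = "1 / (2 * L)"
      have up: "?\<tau> * (\<delta>\<^sup>2 / 2) \<le> \<Psi> (x + ?\<tau> *\<^sub>R g x) - \<Psi> x"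
        using line_ascent[of 0 ?\<tau> \<delta> x] band'[OF that] \<delta> L_pos by simp
      have down: "?\<tau> * (\<delta>\<^sup>2 / 2) \<le> \<Psi> x - \<Psi> (x + (- ?\<tau>) *\<^sub>R g x)"
        using line_ascent[of "- ?\<tau>" 0 \<delta> x] band'[OF that] \<delta> L_pos by simp
      have small: "\<bar>e x\<bar> \<le> ?\<tau> * (\<delta>\<^sup>2 / 2)" using e_small[of x] s' by (simp add: \<epsilon>_def)
      have lo: "\<Psi> (x + (- ?\<tau>) *\<^sub>R g x) \<le> \<Psi> x + e x" and hi: "\<Psi> x + e x \<le> \<Psi> (x + ?\<tau> *\<^sub>R g x)"
        using up down small by linarith+
      have "\<exists>t\<ge>- ?\<tau>. t \<le> ?\<tau> \<and> \<Psi> (x + t *\<^sub>R g x) = \<Psi> x + e x"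
        using L_pos by (intro IVT[where f = "\<lambda>t. \<Psi> (x + t *\<^sub>R g x)", OF lo hi]) (auto intro: DERIV_isCont line_deriv)
      then show ?thesis by (auto simp: abs_le_iff)
    qed
    define \<theta> where "\<theta> = (\<lambda>x. if bump (\<Psi> x) = 0 then 0
      else SOME t. \<bar>t\<bar> \<le> 1 / (2 * L) \<and> \<Psi> (x + t *\<^sub>R g x) = \<Psi> x + e x)"
    have \<theta>: "\<bar>\<theta> x\<bar> \<le> 1 / (2 * L)" "\<Psi> (x + \<theta> x *\<^sub>R g x) = \<Psi> x + e x" for x
    proof -
      have "\<bar>\<theta> x\<bar> \<le> 1 / (2 * L) \<and> \<Psi> (x + \<theta> x *\<^sub>R g x) = \<Psi> x + e x"
      proof (cases "bump (\<Psi> x) = 0")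
        case True then show ?thesis using L_pos by (simp add: \<theta>_def e_def)
      next
        case False
        from someI_ex[OF ex[OF False]] show ?thesis using False by (simp add: \<theta>_def)
      qed
      then show "\<bar>\<theta> x\<bar> \<le> 1 / (2 * L)" "\<Psi> (x + \<theta> x *\<^sub>R g x) = \<Psi> x + e x" by auto
    qed
    have ascent: "\<bar>u - t\<bar> \<le> k * \<bar>\<Psi> (x + u *\<^sub>R g x) - \<Psi> (x + t *\<^sub>R g x)\<bar>"
      if "bump (\<Psi> x) \<noteq> 0" "\<bar>u\<bar> \<le> 1 / (2 * L)" "\<bar>t\<bar> \<le> 1 / (2 * L)" for u t x
    proof -
      have "\<bar>u - t\<bar> * (\<delta>\<^sup>2 / 2) \<le> \<bar>\<Psi> (x + u *\<^sub>R g x) - \<Psi> (x + t *\<^sub>R g x)\<bar>"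
        using line_ascent[of u t \<delta> x] line_ascent[of t u \<delta> x] that band'[of x] \<delta>
        by (cases "t \<le> u") (auto simp: abs_if)
      from mult_left_mono[OF this, of k] k show ?thesis using \<delta> by (simp add: k_def field_simps)
    qed
    have \<theta>_le_e: "\<bar>\<theta> x\<bar> \<le> k * \<bar>e x\<bar>" for x
    proof (cases "bump (\<Psi> x) = 0")
      case False
      from ascent[OF this, of "\<theta> x" 0] \<theta>[of x] L_pos show ?thesis by simp
    qed (simp add: \<theta>_def k less_imp_le)
    \<comment> \<open>Compare the two increments along the line through \<open>y\<close>, at the parameters \<open>\<theta> x\<close> and \<open>\<theta> y\<close>. The case where only the bump at \<open>x\<close> is nonzero follows by symmetry.\<close>
    have \<theta>_lip_aux: "\<bar>\<theta> x - \<theta> y\<bar> \<le> \<bar>s' - s\<bar> * K\<^sub>\<theta> * norm (x - y)" if y: "bump (\<Psi> y) \<noteq> 0" for x y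
    proof -
      have "\<bar>\<theta> x - \<theta> y\<bar> \<le> k * \<bar>\<Psi> (y + \<theta> x *\<^sub>R g y) - \<Psi> (y + \<theta> y *\<^sub>R g y)\<bar>"
        using ascent[OF y \<theta>(1) \<theta>(1)] .
      also have "\<Psi> (y + \<theta> x *\<^sub>R g y) - \<Psi> (y + \<theta> y *\<^sub>R g y)
          = (e x - e y) - ((\<Psi> (x + \<theta> x *\<^sub>R g x) - \<Psi> x) - (\<Psi> (y + \<theta> x *\<^sub>R g y) - \<Psi> y))"
        using \<theta>(2)[of x] \<theta>(2)[of y] by simp
      also have "\<bar>\<dots>\<bar> \<le> \<bar>e x - e y\<bar> + 3 * L * M * norm (x - y) * \<bar>\<theta> x\<bar>"
        using line_increment_lipschitz[OF \<theta>(1), of x x y] by linarith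
      also have "\<dots> \<le> \<bar>s' - s\<bar> * (M / r) * norm (x - y)
          + 3 * L * M * norm (x - y) * (k * \<bar>s' - s\<bar>)"
      proof (intro add_mono e_lip mult_left_mono)
        show "\<bar>\<theta> x\<bar> \<le> k * \<bar>s' - s\<bar>"
          using \<theta>_le_e[of x] mult_left_mono[OF e_small[of x], of k] k by linarith
      qed (use L_pos gradient_bound_nonneg in auto)
      also have "\<dots> = \<bar>s' - s\<bar> * (M / r + 3 * L * M * k) * norm (x - y)" by (simp add: algebra_simps)
      finally show ?thesis using k by (simp add: K\<^sub>\<theta>_def mult.assoc mult.left_commute)
    qed
    have \<theta>_lip: "\<bar>\<theta> x - \<theta> y\<bar> \<le> \<bar>s' - s\<bar> * K\<^sub>\<theta> * norm (x - y)" for x y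
      using \<theta>_lip_aux[of y x] \<theta>_lip_aux[of x y] K
      by (cases "bump (\<Psi> x) = 0"; cases "bump (\<Psi> y) = 0")
         (auto simp: abs_minus_commute norm_minus_commute \<theta>_def)
    have lip_move: "norm (\<theta> x *\<^sub>R g x - \<theta> y *\<^sub>R g y) \<le> \<bar>s' - s\<bar> * K * norm (x - y)" for x y
    proof -
      have "\<theta> x *\<^sub>R g x - \<theta> y *\<^sub>R g y = (\<theta> x - \<theta> y) *\<^sub>R g x + \<theta> y *\<^sub>R (g x - g y)"
        by (simp add: algebra_simps)
      also have "norm \<dots> \<le> \<bar>\<theta> x - \<theta> y\<bar> * norm (g x) + \<bar>\<theta> y\<bar> * norm (g x - g y)"
        by (rule order_trans[OF norm_triangle_ineq]) simp
      also have "\<dots> \<le> (\<bar>s' - s\<bar> * K\<^sub>\<theta> * norm (x - y)) * M + (k * \<bar>s' - s\<bar>) * (L * norm (x - y))"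
      proof (intro add_mono mult_mono \<theta>_lip bound lip)
        show "\<bar>\<theta> y\<bar> \<le> k * \<bar>s' - s\<bar>"
          using \<theta>_le_e[of y] mult_left_mono[OF e_small[of y], of k] k by linarith
      qed (use K k in auto)
      finally show ?thesis by (simp add: K_def algebra_simps)
    qed
    show ?thesis
    proof (rule isotopy_lipschitz_perturbation[OF lip_move])
      show "0 \<le> \<bar>s' - s\<bar> * K" using K by simp
      have "\<bar>s' - s\<bar> * K \<le> 1 / (K + 1) * K"
        using s' K by (intro mult_right_mono) (auto simp: \<epsilon>_def)
      also have "\<dots> < 1" using K by simp
      finally show "\<bar>s' - s\<bar> * K < 1" .
      have surj: "range (\<lambda>x. x + \<theta> x *\<^sub>R g x) = UNIV"
        using homeomorphism_lipschitz_perturbation[OF lip_move \<open>0 \<le> \<bar>s' - s\<bar> * K\<close> \<open>\<bar>s' - s\<bar> * K < 1\<close>]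
        by (auto simp: homeomorphism_def)
      have level: "\<Psi> x = s" if "\<Psi> (x + \<theta> x *\<^sub>R g x) = s'" for x
      proof (rule ccontr)
        assume "\<Psi> x \<noteq> s"
        have "\<Psi> x - s = (s' - s) * (bump s - bump (\<Psi> x))"
          using that \<theta>(2)[of x] by (simp add: e_def bump_def algebra_simps)
        then have "\<bar>\<Psi> x - s\<bar> = \<bar>s' - s\<bar> * \<bar>bump s - bump (\<Psi> x)\<bar>" by (simp only: abs_mult)
        also have "\<dots> \<le> \<bar>s' - s\<bar> * (\<bar>\<Psi> x - s\<bar> / r)"
          using bump_lip[of s "\<Psi> x"] by (intro mult_left_mono) (simp_all only: abs_minus_commute abs_ge_zero)
        finally have "\<bar>\<Psi> x - s\<bar> \<le> \<bar>s' - s\<bar> * (\<bar>\<Psi> x - s\<bar> / r)" .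
        moreover have "\<bar>s' - s\<bar> * (\<bar>\<Psi> x - s\<bar> / r) < r * (\<bar>\<Psi> x - s\<bar> / r)"
          using s' \<open>\<Psi> x \<noteq> s\<close> r by (intro mult_strict_right_mono) (auto simp: \<epsilon>_def)
        ultimately show False using r by simp
      qed
      show "(\<lambda>x. x + \<theta> x *\<^sub>R g x) ` {x. \<Psi> x = s} = {x. \<Psi> x = s'}"
      proof (intro equalityI subsetI)
        fix y assume y: "y \<in> {x. \<Psi> x = s'}"
        have "y \<in> range (\<lambda>x. x + \<theta> x *\<^sub>R g x)" unfolding surj by simp
        then obtain x where x: "y = x + \<theta> x *\<^sub>R g x" by blast
        have "\<Psi> x = s" using y unfolding x by (intro level) blast
        then show "y \<in> (\<lambda>x. x + \<theta> x *\<^sub>R g x) ` {x. \<Psi> x = s}" unfolding x by blast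
      next
        fix y assume "y \<in> (\<lambda>x. x + \<theta> x *\<^sub>R g x) ` {x. \<Psi> x = s}"
        then obtain x where "\<Psi> x = s" "y = x + \<theta> x *\<^sub>R g x" by blast
        then show "y \<in> {x. \<Psi> x = s'}" using \<theta>(2)[of x] by (simp add: e_def bump_def)
      qed
    qed
  qed
  ultimately show ?thesis by blast
qed

text \<open>
  The lower bound \<open>\<delta>\<close> on the gradient is uniform over the noncompact band and so excludes critical points
  at infinity as well. Isotopy of levels is then an equivalence relation that is locally constant on
  an interval.
\<close>
lemma levels_isotopic:
  assumes \<delta>: "0 < \<delta>" and band: "\<And>x. a \<le> \<Psi> x \<Longrightarrow> \<Psi> x \<le> b \<Longrightarrow> \<delta> \<le> norm (g x)"
    and "s \<in> {a<..<b}" "s' \<in> {a<..<b}"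
  shows "same_isotopy_type {x. \<Psi> x = s} {x. \<Psi> x = s'}"
proof (rule connected_equivalence_relation[of "{a<..<b}" s s'
      "\<lambda>s s'. same_isotopy_type {x. \<Psi> x = s} {x. \<Psi> x = s'}"])
  fix u assume u: "u \<in> {a<..<b}"
  define r where "r = min (u - a) (b - u)"
  have "0 < r" using u by (simp add: r_def)
  moreover have "\<delta> \<le> norm (g x)" if "\<bar>\<Psi> x - u\<bar> \<le> r" for x
    using that by (intro band) (auto simp: r_def)
  ultimately obtain \<epsilon> where "0 < \<epsilon>"
    and \<epsilon>: "\<And>s'. \<bar>s' - u\<bar> < \<epsilon> \<Longrightarrow> same_isotopy_type {x. \<Psi> x = u} {x. \<Psi> x = s'}"
    using nearby_levels_isotopic[OF \<delta>] by metis
  show "\<exists>T. openin (top_of_set {a<..<b}) T \<and> u \<in> T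
      \<and> (\<forall>x\<in>T. same_isotopy_type {y. \<Psi> y = u} {y. \<Psi> y = x})"
    using u \<open>0 < \<epsilon>\<close> \<epsilon>
    by (intro exI[of _ "{a<..<b} \<inter> ball u \<epsilon>"]) (auto simp: dist_real_def abs_minus_commute intro: openin_open_Int)
next
  fix u v w
  assume "same_isotopy_type {x. \<Psi> x = u} {x. \<Psi> x = v}" "same_isotopy_type {x. \<Psi> x = v} {x. \<Psi> x = w}"
  then show "same_isotopy_type {x. \<Psi> x = u} {x. \<Psi> x = w}" by (rule same_isotopy_type_trans)
next
  fix u v
  assume "same_isotopy_type {x. \<Psi> x = u} {x. \<Psi> x = v}"
  then show "same_isotopy_type {x. \<Psi> x = v} {x. \<Psi> x = u}" by (rule same_isotopy_type_sym)
qed (use assms in simp_all)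

end

section \<open>Sets that are star-shaped over the same cone\<close>

text \<open>
  Meant for a positively homogeneous \<open>S\<close> of degree 1 and a function \<open>e > -1\<close> that is constant on rays.
  In terms of \<open>u = S x\<close> the map acts on a ray as \<open>u \<mapsto> T/2 + (u - T/2) * (1 + e)\<close> beyond \<open>u = T/2\<close>. It is
  the identity where \<open>S x \<le> T/2\<close>, hence near the boundary of the cone \<open>{x. 0 < S x}\<close>, where \<open>e\<close> may have no limit.
\<close>
definition ray_stretch :: "(real^'n \<Rightarrow> real) \<Rightarrow> real \<Rightarrow> (real^'n \<Rightarrow> real) \<Rightarrow> real^'n \<Rightarrow> real^'n" where
  "ray_stretch S T e x =
     (if S x \<le> T / 2 then x else (1 + (1 - T / (2 * S x)) * e x) *\<^sub>R x)"

context
  fixes S :: "real^'n \<Rightarrow> real" and T :: real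
  assumes S_cont: "continuous_on UNIV S"
    and S_hom: "\<And>r x. 0 < r \<Longrightarrow> S (r *\<^sub>R x) = r * S x"
    and T_pos: "0 < T"
begin

lemma continuous_on_ray_stretch:
  assumes e: "continuous_on ({0..1} \<times> {x. 0 < S x}) (\<lambda>(t, x). e t x)"
  shows "continuous_on ({0..1} \<times> UNIV) (\<lambda>(t::real, x). ray_stretch S T (e t) x)"
proof -
  let ?U = "{0..1::real} \<times> (UNIV :: (real^'n) set)"
  have cS: "continuous_on X (\<lambda>p. S (snd p))" for X :: "(real \<times> (real^'n)) set"
    by (rule continuous_on_compose2[OF S_cont]) (auto intro: continuous_intros)
  have "continuous_on ({p\<in>?U. S (snd p) \<le> T / 2} \<union> {p\<in>?U. T / 2 \<le> S (snd p)})
    (\<lambda>p. if S (snd p) \<le> T / 2 then snd p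
       else (1 + (1 - T / (2 * S (snd p))) * e (fst p) (snd p)) *\<^sub>R snd p)"
  proof (rule continuous_on_cases_local)
    let ?X = "{p\<in>?U. S (snd p) \<le> T / 2}" and ?Y = "{p\<in>?U. T / 2 \<le> S (snd p)}"
    have eq: "?X \<union> ?Y = ?U" by auto
    show "closedin (top_of_set (?X \<union> ?Y)) ?X"
      unfolding eq using continuous_closedin_preimage[OF cS[of ?U], of "{..T/2}"]
      by (simp add: vimage_def Int_def)
    show "closedin (top_of_set (?X \<union> ?Y)) ?Y"
      unfolding eq using continuous_closedin_preimage[OF cS[of ?U], of "{T/2..}"]
      by (simp add: vimage_def Int_def)
    have "continuous_on ?Y (\<lambda>p. e (fst p) (snd p))"
      using T_pos by (intro continuous_on_subset[OF e[unfolded split_def]]) auto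
    then show "continuous_on ?Y (\<lambda>p. (1 + (1 - T / (2 * S (snd p))) * e (fst p) (snd p)) *\<^sub>R snd p)"
      using T_pos by (intro continuous_intros cS) auto
  qed (use T_pos in \<open>auto intro: continuous_intros\<close>)
  moreover have "{p\<in>?U. S (snd p) \<le> T / 2} \<union> {p\<in>?U. T / 2 \<le> S (snd p)} = ?U" by auto
  ultimately show ?thesis by (simp add: ray_stretch_def split_def)
qed

lemma stretch_factor:
  fixes u e :: real
  assumes "T / 2 < u" "-1 < e"
  shows "0 < 1 + (1 - T / (2 * u)) * e" "(1 + (1 - T / (2 * u)) * e) * u = T / 2 + (u - T / 2) * (1 + e)"
proof -
  have u: "0 < u" using assms(1) T_pos by linarith
  show eq: "(1 + (1 - T / (2 * u)) * e) * u = T / 2 + (u - T / 2) * (1 + e)"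
    using u by (simp add: field_simps)
  have "0 < (u - T / 2) * (1 + e)" using assms by (intro mult_pos_pos) auto
  then have "0 < (1 + (1 - T / (2 * u)) * e) * u" unfolding eq using T_pos by linarith
  then show "0 < 1 + (1 - T / (2 * u)) * e" using u by (simp add: zero_less_mult_iff)
qed

text \<open>
  On the part \<open>u > T/2\<close> of each ray the map is affine with slope \<open>1 + e\<close> and fixes \<open>u = T/2\<close>; inverting the
  slope inverts the map.
\<close>
lemma ray_stretch_inverse:
  assumes e: "\<And>x. 0 < S x \<Longrightarrow> -1 < e x" and e_hom: "\<And>r x. 0 < r \<Longrightarrow> 0 < S x \<Longrightarrow> e (r *\<^sub>R x) = e x"
  shows "ray_stretch S T (\<lambda>x. 1 / (1 + e x) - 1) (ray_stretch S T e x) = x"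
proof (cases "S x \<le> T / 2")
  case True then show ?thesis by (simp add: ray_stretch_def)
next
  case False
  let ?u = "S x" and ?m = "1 + (1 - T / (2 * S x)) * e x"
  have u: "0 < ?u" "T / 2 < ?u" using False T_pos by auto
  have m: "0 < ?m" and mu: "?m * ?u = T / 2 + (?u - T / 2) * (1 + e x)"
    using stretch_factor[OF u(2) e[OF u(1)]] by auto
  have e1: "0 < 1 + e x" using e[OF u(1)] by simp
  have S': "S (?m *\<^sub>R x) = ?m * ?u" using S_hom[OF m] .
  have big: "T / 2 < ?m * ?u"
  proof -
    have "0 < (?u - T / 2) * (1 + e x)" using u e1 by (intro mult_pos_pos) auto
    then show ?thesis unfolding mu by linarith
  qed
  have e': "-1 < 1 / (1 + e x) - 1" using e1 by simp
  have "(1 + (1 - T / (2 * (?m * ?u))) * (1 / (1 + e x) - 1)) * (?m * ?u)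
      = T / 2 + (?m * ?u - T / 2) * (1 / (1 + e x))"
    using stretch_factor(2)[OF big e'] by simp
  also have "\<dots> = ?u" unfolding mu using e1 by simp
  finally have "(1 + (1 - T / (2 * (?m * ?u))) * (1 / (1 + e x) - 1)) * ?m = 1"
    using u by (metis mult.assoc mult_cancel_right1 less_irrefl)
  then show ?thesis
    using False big S' e_hom[OF m u(1)] by (simp add: ray_stretch_def)
qed

lemma homeomorphism_ray_stretch:
  assumes e: "\<And>x. 0 < S x \<Longrightarrow> -1 < e x" and e_hom: "\<And>r x. 0 < r \<Longrightarrow> 0 < S x \<Longrightarrow> e (r *\<^sub>R x) = e x"
    and e_cont: "continuous_on {x. 0 < S x} e"
  shows "\<exists>g. homeomorphism UNIV UNIV (ray_stretch S T e) g"
proof -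
  have cont: "continuous_on UNIV (ray_stretch S T e)" if "continuous_on {x. 0 < S x} e" for e
  proof -
    have "continuous_on ({0..1} \<times> {x. 0 < S x}) (\<lambda>(t::real, x). e x)"
      unfolding split_def by (rule continuous_on_compose2[OF that]) (auto intro: continuous_intros)
    from continuous_on_ray_stretch[OF this]
    have c: "continuous_on ({0..1} \<times> UNIV) (\<lambda>(t::real, x). ray_stretch S T e x)" .
    have "continuous_on UNIV ((\<lambda>(t::real, x). ray_stretch S T e x) \<circ> (\<lambda>x. (0, x)))"
      by (intro continuous_on_compose continuous_on_subset[OF c] continuous_intros) auto
    then show ?thesis by (simp add: o_def)
  qed
  let ?e' = "\<lambda>x. 1 / (1 + e x) - 1"
  have inv: "ray_stretch S T ?e' (ray_stretch S T e x) = x" for x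
    by (rule ray_stretch_inverse[OF e e_hom])
  have "ray_stretch S T (\<lambda>x. 1 / (1 + ?e' x) - 1) (ray_stretch S T ?e' x) = x" for x
  proof (rule ray_stretch_inverse)
    show "- 1 < ?e' x" if "0 < S x" for x using e[OF that] by simp
  qed (use e_hom in auto)
  then have inv': "ray_stretch S T e (ray_stretch S T ?e' x) = x" for x by simp
  have "continuous_on {x. 0 < S x} ?e'"
    using e by (intro continuous_intros e_cont) force
  from cont[OF this] cont[OF e_cont] have "homeomorphism UNIV UNIV (ray_stretch S T e) (ray_stretch S T ?e')"
    by (intro homeomorphismI) (use inv inv' in auto)
  then show ?thesis by blast
qed

text \<open>
  Both sets meet each ray of the cone \<open>{x. 0 < S x}\<close> once and meet no other ray. The stretch with
  \<open>e = 2 * (\<rho> - 1)\<close> carries the first point to the second one, and \<open>1/2 < \<rho>\<close> keeps \<open>e\<close> above \<open>-1\<close>.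
\<close>
lemma star_shaped_isotopic:
  assumes \<rho>_cont: "continuous_on {x. 0 < S x} \<rho>"
    and \<rho>_hom: "\<And>r x. 0 < r \<Longrightarrow> 0 < S x \<Longrightarrow> \<rho> (r *\<^sub>R x) = \<rho> x"
    and \<rho>_large: "\<And>x. 0 < S x \<Longrightarrow> 1 / 2 < \<rho> x"
  shows "same_isotopy_type {x. S x = T} {x. 0 < S x \<and> S x = T * \<rho> x}"
proof -
  define e where "e = (\<lambda>t x. t * (2 * (\<rho> x - 1)))"
  define H where "H = (\<lambda>(t::real, x). ray_stretch S T (e t) x)"
  have "continuous_on ({0..1::real} \<times> {x. 0 < S x}) (\<lambda>p. \<rho> (snd p))"
    by (rule continuous_on_compose2[OF \<rho>_cont]) (auto intro: continuous_intros)
  then have "continuous_on ({0..1} \<times> {x. 0 < S x}) (\<lambda>(t, x). e t x)"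
    unfolding e_def split_def by (intro continuous_intros)
  from continuous_on_ray_stretch[OF this] have "continuous_on ({0..1} \<times> UNIV) H" by (simp add: H_def)
  moreover have "\<exists>g. homeomorphism UNIV UNIV (\<lambda>x. H (t, x)) g" if t: "t \<in> {0..1}" for t
  proof -
    have "-1 < e t x" if x: "0 < S x" for x
    proof -
      have "0 \<le> t * (2 * \<rho> x - 1)" using t \<rho>_large[OF x] by simp
      then have "-t \<le> e t x" by (simp add: e_def algebra_simps)
      moreover have "e t x \<noteq> -1" 
      proof 
        assume a: "e t x = -1"
        then have "t = 1" using \<open>-t \<le> e t x\<close> t by auto
        with a \<rho>_large[OF x] show False by (simp add: e_def)
      qed
      ultimately show ?thesis using t by auto
    qed
    moreover have "continuous_on {x. 0 < S x} (e t)" unfolding e_def by (intro continuous_intros \<rho>_cont)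
    ultimately have "\<exists>g. homeomorphism UNIV UNIV (ray_stretch S T (e t)) g"
      using \<rho>_hom by (intro homeomorphism_ray_stretch) (auto simp: e_def)
    then show ?thesis by (simp add: H_def)
  qed
  moreover have "H (0, x) = x" for x by (simp add: H_def e_def ray_stretch_def)
  moreover have "(\<lambda>x. H (1, x)) ` {x. S x = T} = {x. 0 < S x \<and> S x = T * \<rho> x}"
  proof -
    have H1: "H (1, x) = \<rho> x *\<^sub>R x" if "S x = T" for x
      using that T_pos by (simp add: H_def e_def ray_stretch_def diff_divide_distrib)
    show ?thesis
    proof (intro equalityI subsetI)
      fix y assume "y \<in> (\<lambda>x. H (1, x)) ` {x. S x = T}"
      then obtain x where x: "S x = T" "y = \<rho> x *\<^sub>R x" using H1 by auto
      then have "0 < \<rho> x" using \<rho>_large[of x] T_pos by simp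
      then show "y \<in> {x. 0 < S x \<and> S x = T * \<rho> x}"
        using x S_hom[of "\<rho> x" x] \<rho>_hom[of "\<rho> x" x] T_pos by simp
    next
      fix y assume "y \<in> {x. 0 < S x \<and> S x = T * \<rho> x}"
      then have y: "0 < S y" "S y = T * \<rho> y" by auto
      then have p: "0 < \<rho> y" using \<rho>_large[of y] by simp
      have "S ((1 / \<rho> y) *\<^sub>R y) = T" using S_hom[of "1 / \<rho> y" y] p y by simp
      moreover have "y = \<rho> ((1 / \<rho> y) *\<^sub>R y) *\<^sub>R ((1 / \<rho> y) *\<^sub>R y)"
        using \<rho>_hom[of "1 / \<rho> y" y] p y by simp
      ultimately show "y \<in> (\<lambda>x. H (1, x)) ` {x. S x = T}" using H1 by (metis (mono_tags) image_eqI mem_Collect_eq)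
    qed
  qed
  ultimately show ?thesis unfolding same_isotopy_type_def by blast
qed

end

section \<open>Exponential sums and their logarithmic ratio\<close>

definition weighted_mean :: "(real^'n) set \<Rightarrow> (real^'n \<Rightarrow> real) \<Rightarrow> real^'n \<Rightarrow> real^'n" where
  "weighted_mean B d x = (\<Sum>\<beta>\<in>B. (d \<beta> * exp (\<beta> \<bullet> x)) *\<^sub>R \<beta>) /\<^sub>R exp_sum B d x"

text \<open>
  For the sets \<open>P\<close> and \<open>N\<close> of positive and negative exponents and \<open>d = \<bar>c\<bar>\<close>, the exponential sum is
  \<open>exp_sum P d - exp_sum N d\<close>. The level set of this function at \<open>\<tau>\<close> is the zero set of the sum whose
  positive coefficients have been multiplied by \<open>exp \<tau>\<close>.
\<close>
definition log_ratio ::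
    "(real^'n) set \<Rightarrow> (real^'n) set \<Rightarrow> (real^'n \<Rightarrow> real) \<Rightarrow> real^'n \<Rightarrow> real" where
  "log_ratio P N d x = ln (exp_sum N d x) - ln (exp_sum P d x)"

definition log_ratio_grad ::
    "(real^'n) set \<Rightarrow> (real^'n) set \<Rightarrow> (real^'n \<Rightarrow> real) \<Rightarrow> real^'n \<Rightarrow> real^'n" where
  "log_ratio_grad P N d x = weighted_mean N d x - weighted_mean P d x"

lemma exp_sum_pos:
  assumes "finite B" "B \<noteq> {}" "\<And>\<beta>. \<beta> \<in> B \<Longrightarrow> 0 < d \<beta>"
  shows "0 < exp_sum B d x"
  unfolding exp_sum_def using assms by (intro sum_pos) auto

lemma weighted_mean_inner:
  "weighted_mean B d x \<bullet> v = (\<Sum>\<beta>\<in>B. d \<beta> * exp (\<beta> \<bullet> x) * (\<beta> \<bullet> v)) / exp_sum B d x"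
  by (simp add: weighted_mean_def inner_sum_left divide_inverse mult.commute)

lemma weighted_mean_inner_shift:
  assumes "finite B" "B \<noteq> {}" "\<And>\<beta>. \<beta> \<in> B \<Longrightarrow> 0 < d \<beta>"
  shows "weighted_mean B d x \<bullet> v - a = (\<Sum>\<beta>\<in>B. d \<beta> * exp (\<beta> \<bullet> x) * (\<beta> \<bullet> v - a)) / exp_sum B d x"
  using exp_sum_pos[of B d x] assms
  by (simp add: weighted_mean_inner field_simps exp_sum_def sum_distrib_left sum_subtractf right_diff_distrib)

lemma exp_sum_has_derivative:
  "(exp_sum B d has_derivative (\<lambda>h. (\<Sum>\<beta>\<in>B. d \<beta> * exp (\<beta> \<bullet> x) * (\<beta> \<bullet> h)))) (at x)"
proof -
  have "((\<lambda>x. \<Sum>\<beta>\<in>B. d \<beta> * exp (\<beta> \<bullet> x)) has_derivative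
      (\<lambda>h. (\<Sum>\<beta>\<in>B. d \<beta> * (exp (\<beta> \<bullet> x) * (\<beta> \<bullet> h))))) (at x)"
    by (auto intro!: derivative_eq_intros sum.cong simp: fun_eq_iff algebra_simps)
  then show ?thesis by (simp add: exp_sum_def[abs_def] mult.assoc)
qed

lemma continuous_on_exp_sum: "continuous_on X (exp_sum B d)"
  unfolding exp_sum_def[abs_def] by (intro continuous_intros)

lemma ln_exp_sum_has_derivative:
  assumes "finite B" "B \<noteq> {}" "\<And>\<beta>. \<beta> \<in> B \<Longrightarrow> 0 < d \<beta>"
  shows "((\<lambda>x. ln (exp_sum B d x)) has_derivative (\<lambda>h. weighted_mean B d x \<bullet> h)) (at x)"
proof -
  have pos: "0 < exp_sum B d x" using assms by (rule exp_sum_pos)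
  show ?thesis
    by (rule has_derivative_eq_rhs[OF has_derivative_ln[OF pos exp_sum_has_derivative]])
       (simp add: fun_eq_iff weighted_mean_inner divide_inverse mult.commute)
qed

lemma log_ratio_has_derivative:
  assumes "finite P" "P \<noteq> {}" "finite N" "N \<noteq> {}" "\<And>\<beta>. \<beta> \<in> P \<union> N \<Longrightarrow> 0 < d \<beta>"
  shows "(log_ratio P N d has_derivative (\<lambda>h. log_ratio_grad P N d x \<bullet> h)) (at x)"
  unfolding log_ratio_def[abs_def] log_ratio_grad_def inner_diff_left
  using assms by (intro has_derivative_diff ln_exp_sum_has_derivative) auto

lemma norm_weighted_mean_le:
  assumes "finite B" "B \<noteq> {}" "\<And>\<beta>. \<beta> \<in> B \<Longrightarrow> 0 < d \<beta>" and R: "\<And>\<beta>. \<beta> \<in> B \<Longrightarrow> norm \<beta> \<le> R"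
  shows "norm (weighted_mean B d x) \<le> R"
proof -
  have pos: "0 < exp_sum B d x" using assms by (auto intro!: exp_sum_pos)
  have "norm (\<Sum>\<beta>\<in>B. (d \<beta> * exp (\<beta> \<bullet> x)) *\<^sub>R \<beta>) \<le> (\<Sum>\<beta>\<in>B. d \<beta> * exp (\<beta> \<bullet> x) * R)"
    using assms(3) by (intro sum_norm_le) (auto intro!: mult_left_mono R simp: abs_mult less_imp_le)
  also have "\<dots> = exp_sum B d x * R" by (simp add: exp_sum_def sum_distrib_right)
  finally show ?thesis using pos by (simp add: weighted_mean_def field_simps)
qed

text \<open>
  The derivative of the mean is the covariance of the exponents under the weights, which is bounded
  in terms of the size of the exponents alone.
\<close>
lemma weighted_mean_lipschitz:
  assumes B: "finite B" "B \<noteq> {}" "\<And>\<beta>. \<beta> \<in> B \<Longrightarrow> 0 < d \<beta>" and R: "\<And>\<beta>. \<beta> \<in> B \<Longrightarrow> norm \<beta> \<le> R"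
  shows "norm (weighted_mean B d x - weighted_mean B d y) \<le> 2 * R\<^sup>2 * norm (x - y)"
proof -
  let ?E = "exp_sum B d"
  have pos: "0 < ?E z" for z using B by (auto intro!: exp_sum_pos)
  have R0: "0 \<le> R" using R B norm_ge_zero order_trans by (metis ex_in_conv)
  define w where "w = (\<lambda>z \<beta>. d \<beta> * exp (\<beta> \<bullet> z) / ?E z)"
  have w0: "0 \<le> w z \<beta>" if "\<beta> \<in> B" for z \<beta>
    using that B(3) pos[of z] by (simp add: w_def less_imp_le)
  have w1: "(\<Sum>\<beta>\<in>B. w z \<beta>) = 1" for z
    using pos[of z] by (simp add: w_def sum_divide_distrib[symmetric] exp_sum_def)
  have mean: "weighted_mean B d z = (\<Sum>\<beta>\<in>B. w z \<beta> *\<^sub>R \<beta>)" for z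
    by (simp add: weighted_mean_def w_def scaleR_sum_right divide_inverse mult.commute)
  have w_deriv: "((\<lambda>z. w z \<beta>) has_derivative (\<lambda>h. w z \<beta> * ((\<beta> - weighted_mean B d z) \<bullet> h))) (at z)"
    for z \<beta>
    unfolding w_def using pos[of z]
    by (auto intro!: derivative_eq_intros exp_sum_has_derivative
        simp: fun_eq_iff inner_diff_left weighted_mean_inner field_simps)
  define D where "D = (\<lambda>z h. \<Sum>\<beta>\<in>B. (w z \<beta> * ((\<beta> - weighted_mean B d z) \<bullet> h)) *\<^sub>R \<beta>)"
  have deriv: "(weighted_mean B d has_derivative D z) (at z)" for z
  proof -
    have "((\<lambda>z. \<Sum>\<beta>\<in>B. w z \<beta> *\<^sub>R \<beta>) has_derivative D z) (at z)"
      unfolding D_def by (intro has_derivative_sum has_derivative_scaleR_left w_deriv)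
    then show ?thesis using mean by presburger
  qed
  have "onorm (D z) \<le> 2 * R\<^sup>2" for z
  proof (rule onorm_le)
    fix h
    have "norm (D z h) \<le> (\<Sum>\<beta>\<in>B. w z \<beta> * (2 * R * norm h * R))"
      unfolding D_def
    proof (rule sum_norm_le)
      fix \<beta> assume \<beta>: "\<beta> \<in> B"
      have "norm (\<beta> - weighted_mean B d z) \<le> R + R"
        using R[OF \<beta>] norm_weighted_mean_le[OF B R] by (meson add_mono norm_triangle_ineq4 order_trans)
      then have "\<bar>(\<beta> - weighted_mean B d z) \<bullet> h\<bar> \<le> 2 * R * norm h"
        by (intro order_trans[OF Cauchy_Schwarz_ineq2] mult_right_mono) auto
      then have "w z \<beta> * (\<bar>(\<beta> - weighted_mean B d z) \<bullet> h\<bar> * norm \<beta>) \<le> w z \<beta> * (2 * R * norm h * R)"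
        using R[OF \<beta>] R0 by (intro mult_left_mono w0 \<beta> mult_mono) auto
      then show "norm ((w z \<beta> * ((\<beta> - weighted_mean B d z) \<bullet> h)) *\<^sub>R \<beta>) \<le> w z \<beta> * (2 * R * norm h * R)"
        using w0[OF \<beta>, of z] by (simp add: abs_mult mult.assoc)
    qed
    also have "\<dots> = 2 * R\<^sup>2 * norm h"
      by (simp add: sum_distrib_right[symmetric] w1 power2_eq_square)
    finally show "norm (D z h) \<le> 2 * R\<^sup>2 * norm h" .
  qed
  with deriv show ?thesis
    by (intro differentiable_bound[of UNIV "weighted_mean B d" D]) auto
qed

section \<open>Domination of exponential sums\<close>

text \<open>
  The exponential case of the convex order: two probability measures on \<open>P\<close> and on \<open>N\<close> with the same
  barycenter are compared by integrating \<open>exp (\<alpha> \<bullet> v)\<close>. One function \<open>k\<close> carries both sets of weights,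
  which is unambiguous when \<open>P\<close> and \<open>N\<close> are disjoint.
\<close>
definition exp_dominated :: "(real^'n) set \<Rightarrow> (real^'n) set \<Rightarrow> bool" where
  "exp_dominated P N \<longleftrightarrow>
     (\<forall>k v. (\<forall>\<alpha>\<in>P. 0 \<le> k \<alpha>) \<longrightarrow> (\<forall>\<beta>\<in>N. 0 \<le> k \<beta>) \<longrightarrow> sum k P = 1 \<longrightarrow> sum k N = 1 \<longrightarrow>
        (\<Sum>\<alpha>\<in>P. k \<alpha> *\<^sub>R \<alpha>) = (\<Sum>\<beta>\<in>N. k \<beta> *\<^sub>R \<beta>) \<longrightarrow> exp_sum P k v \<le> exp_sum N k v)"

text \<open>
  Sum the tangent inequality of the exponential function at the mean \<open>m\<close>.
\<close>
lemma exp_jensen: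
  fixes u w :: "'a \<Rightarrow> real"
  assumes "\<And>i. i \<in> I \<Longrightarrow> 0 \<le> w i" and "sum w I = W"
    and mean: "(\<Sum>i\<in>I. w i * u i) = W * m"
  shows "W * exp m \<le> (\<Sum>i\<in>I. w i * exp (u i))"
proof -
  have "W * exp m = exp m * (\<Sum>i\<in>I. w i * (1 + (u i - m)))"
    using mean by (simp add: algebra_simps sum.distrib sum_subtractf sum_distrib_left[symmetric] assms(2))
  also have "\<dots> = (\<Sum>i\<in>I. w i * (exp m * (1 + (u i - m))))"
    by (simp add: sum_distrib_left algebra_simps)
  also have "\<dots> \<le> (\<Sum>i\<in>I. w i * exp (u i))"
  proof (intro sum_mono mult_left_mono assms(1))
    fix i
    have "exp m * (1 + (u i - m)) \<le> exp m * exp (u i - m)"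
      using exp_ge_add_one_self by (intro mult_left_mono) auto
    then show "exp m * (1 + (u i - m)) \<le> exp (u i)" by (simp add: exp_diff)
  qed
  finally show ?thesis .
qed

lemma exp_dominated_singleton:
  fixes N :: "(real^'n) set"
  shows "exp_dominated {\<beta>\<^sub>0} N"
  unfolding exp_dominated_def
proof (intro allI impI)
  fix k :: "real^'n \<Rightarrow> real" and v
  assume k: "\<forall>\<beta>\<in>N. 0 \<le> k \<beta>" "sum k {\<beta>\<^sub>0} = 1" "sum k N = 1"
    and bary: "(\<Sum>\<alpha>\<in>{\<beta>\<^sub>0}. k \<alpha> *\<^sub>R \<alpha>) = (\<Sum>\<beta>\<in>N. k \<beta> *\<^sub>R \<beta>)"
  have "(\<Sum>\<beta>\<in>N. k \<beta> * (\<beta> \<bullet> v)) = (\<Sum>\<beta>\<in>N. k \<beta> *\<^sub>R \<beta>) \<bullet> v" by (simp add: inner_sum_left)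
  also have "\<dots> = 1 * (\<beta>\<^sub>0 \<bullet> v)" using bary k by simp
  finally have "1 * exp (\<beta>\<^sub>0 \<bullet> v) \<le> (\<Sum>\<beta>\<in>N. k \<beta> * exp (\<beta> \<bullet> v))"
    using k by (intro exp_jensen) auto
  then show "exp_sum {\<beta>\<^sub>0} k v \<le> exp_sum N k v" using k by (simp add: exp_sum_def)
qed

lemma exp_le_barycentric_convex_hull:
  fixes C :: "(real^'n) set"
  assumes C: "finite C" and \<alpha>: "\<alpha> \<in> convex hull C"
  obtains l where "sum l C = 1" "(\<Sum>\<mu>\<in>C. l \<mu> *\<^sub>R \<mu>) = \<alpha>"
    "\<And>v. exp (\<alpha> \<bullet> v) \<le> (\<Sum>\<mu>\<in>C. l \<mu> * exp (\<mu> \<bullet> v))"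
proof -
  obtain l where l: "\<forall>\<mu>\<in>C. 0 \<le> l \<mu>" "sum l C = 1" "(\<Sum>\<mu>\<in>C. l \<mu> *\<^sub>R \<mu>) = \<alpha>"
    using \<alpha> unfolding convex_hull_finite[OF C] by auto
  have "1 * exp (\<alpha> \<bullet> v) \<le> (\<Sum>\<mu>\<in>C. l \<mu> * exp (\<mu> \<bullet> v))" for v
    using l by (intro exp_jensen) (auto simp: inner_sum_left)
  then show ?thesis using that l by auto
qed

text \<open>
  In barycentric coordinates a point of the opposite cone at \<open>m\<close> has its only positive coordinate at
  \<open>m\<close>. Solving for \<open>m\<close> exhibits \<open>m\<close> as a convex combination of \<open>\<beta>\<close> and the other vertices, and Jensen's
  inequality for this combination is the reversed inequality for \<open>\<beta>\<close>.
\<close>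
lemma exp_ge_barycentric_opposite_cone:
  fixes C :: "(real^'n) set"
  assumes C: "finite C" "m \<in> C" and \<beta>: "\<beta> \<in> opposite_cone C m"
  obtains l where "sum l C = 1" "(\<Sum>\<mu>\<in>C. l \<mu> *\<^sub>R \<mu>) = \<beta>"
    "\<And>v. (\<Sum>\<mu>\<in>C. l \<mu> * exp (\<mu> \<bullet> v)) \<le> exp (\<beta> \<bullet> v)"
proof -
  obtain r where r: "\<forall>\<mu>\<in>C. 0 \<le> r \<mu>" and \<beta>: "\<beta> = m + (\<Sum>\<mu>\<in>C. r \<mu> *\<^sub>R (m - \<mu>))"
    using \<beta> by (auto simp: opposite_cone_def)
  define l where "l = (\<lambda>\<mu>. (if \<mu> = m then 1 + sum r C else 0) - r \<mu>)"
  have split: "(\<Sum>\<mu>\<in>C. l \<mu> *\<^sub>R f \<mu>) = (1 + sum r C) *\<^sub>R f m - (\<Sum>\<mu>\<in>C. r \<mu> *\<^sub>R f \<mu>)"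
    for f :: "real^'n \<Rightarrow> 'b::real_vector"
    using C by (simp add: l_def scaleR_diff_left sum_subtractf if_distrib[of "\<lambda>c. c *\<^sub>R _"] cong: if_cong)
  have "sum l C = 1" using split[of "\<lambda>_. 1::real"] by simp
  moreover have "(\<Sum>\<mu>\<in>C. l \<mu> *\<^sub>R \<mu>) = \<beta>"
    by (simp add: split \<beta> scaleR_diff_right sum_subtractf scaleR_left_distrib scaleR_sum_left)
  moreover have "(\<Sum>\<mu>\<in>C. l \<mu> * exp (\<mu> \<bullet> v)) \<le> exp (\<beta> \<bullet> v)" for v
  proof -
    \<comment> \<open>The index \<open>None\<close> stands for \<open>\<beta>\<close>, which may coincide with a vertex.\<close>
    define w where "w = case_option 1 r"
    define u where "u = case_option (\<beta> \<bullet> v) (\<lambda>\<mu>. \<mu> \<bullet> v)"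
    let ?I = "insert None (Some ` C)"
    have sum_I: "sum F ?I = F None + (\<Sum>\<mu>\<in>C. F (Some \<mu>))" for F :: "(real^'n) option \<Rightarrow> real"
      using C by (simp add: sum.reindex)
    have "(1 + sum r C) * exp (m \<bullet> v) \<le> (\<Sum>i\<in>?I. w i * exp (u i))"
    proof (rule exp_jensen)
      show "0 \<le> w i" if "i \<in> ?I" for i using that r by (auto simp: w_def)
      show "sum w ?I = 1 + sum r C" by (simp add: sum_I w_def)
      show "(\<Sum>i\<in>?I. w i * u i) = (1 + sum r C) * (m \<bullet> v)"
        by (simp add: sum_I w_def u_def \<beta> inner_add_left inner_sum_left inner_diff_left
            sum_subtractf sum_distrib_right algebra_simps)
    qed
    also have "\<dots> = exp (\<beta> \<bullet> v) + (\<Sum>\<mu>\<in>C. r \<mu> * exp (\<mu> \<bullet> v))" by (simp add: sum_I w_def u_def)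
    finally show ?thesis using split[of "\<lambda>\<mu>. exp (\<mu> \<bullet> v)"] by simp
  qed
  ultimately show ?thesis using that by blast
qed

text \<open>
  Sweeping all masses to the vertices of the simplex, with barycentric coordinates as weights, can
  only increase the integral for points of the simplex and only decrease it for points of the
  opposite cones. Equal barycenters produce the same measure on the affinely independent vertices.
\<close>
lemma exp_dominated_simplex:
  fixes S :: "(real^'n) set"
  assumes S: "n simplex S" and P: "P \<subseteq> S" and N: "N \<subseteq> simplex_opposite S" 
  shows "exp_dominated P N"
proof -
  obtain C where C: "\<not> affine_dependent C" "S = convex hull C" and fin: "finite C"
    using S unfolding simplex by blast
  have verts: "{\<mu>. \<mu> extreme_point_of S} = C"
    unfolding C(2) using extreme_point_of_convex_hull_affine_independent[OF C(1)] by simp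
  have "\<forall>\<alpha>\<in>P. \<exists>l. sum l C = 1 \<and> (\<Sum>\<mu>\<in>C. l \<mu> *\<^sub>R \<mu>) = \<alpha> \<and>
      (\<forall>v. exp (\<alpha> \<bullet> v) \<le> (\<Sum>\<mu>\<in>C. l \<mu> * exp (\<mu> \<bullet> v)))"
  proof
    fix \<alpha> assume "\<alpha> \<in> P"
    then have "\<alpha> \<in> convex hull C" using P C(2) by blast
    then show "\<exists>l. sum l C = 1 \<and> (\<Sum>\<mu>\<in>C. l \<mu> *\<^sub>R \<mu>) = \<alpha> \<and>
      (\<forall>v. exp (\<alpha> \<bullet> v) \<le> (\<Sum>\<mu>\<in>C. l \<mu> * exp (\<mu> \<bullet> v)))"
      by (rule exp_le_barycentric_convex_hull[OF fin]) blast
  qed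
  from bchoice[OF this] obtain p where
    "\<forall>\<alpha>\<in>P. sum (p \<alpha>) C = 1 \<and> (\<Sum>\<mu>\<in>C. p \<alpha> \<mu> *\<^sub>R \<mu>) = \<alpha> \<and>
      (\<forall>v. exp (\<alpha> \<bullet> v) \<le> (\<Sum>\<mu>\<in>C. p \<alpha> \<mu> * exp (\<mu> \<bullet> v)))" ..
  then have p: "\<And>\<alpha>. \<alpha> \<in> P \<Longrightarrow> sum (p \<alpha>) C = 1"
      "\<And>\<alpha>. \<alpha> \<in> P \<Longrightarrow> (\<Sum>\<mu>\<in>C. p \<alpha> \<mu> *\<^sub>R \<mu>) = \<alpha>"
      "\<And>\<alpha> v. \<alpha> \<in> P \<Longrightarrow> exp (\<alpha> \<bullet> v) \<le> (\<Sum>\<mu>\<in>C. p \<alpha> \<mu> * exp (\<mu> \<bullet> v))"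
    by blast+
  have "\<forall>\<beta>\<in>N. \<exists>l. sum l C = 1 \<and> (\<Sum>\<mu>\<in>C. l \<mu> *\<^sub>R \<mu>) = \<beta> \<and>
      (\<forall>v. (\<Sum>\<mu>\<in>C. l \<mu> * exp (\<mu> \<bullet> v)) \<le> exp (\<beta> \<bullet> v))"
  proof
    fix \<beta> assume "\<beta> \<in> N"
    then have "\<beta> \<in> (\<Union>m\<in>C. opposite_cone C m)" using N unfolding simplex_opposite_def verts by blast
    then obtain m where m: "m \<in> C" "\<beta> \<in> opposite_cone C m" by blast
    then show "\<exists>l. sum l C = 1 \<and> (\<Sum>\<mu>\<in>C. l \<mu> *\<^sub>R \<mu>) = \<beta> \<and>
      (\<forall>v. (\<Sum>\<mu>\<in>C. l \<mu> * exp (\<mu> \<bullet> v)) \<le> exp (\<beta> \<bullet> v))"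
      by (rule exp_ge_barycentric_opposite_cone[OF fin]) blast
  qed
  from bchoice[OF this] obtain q where
    "\<forall>\<beta>\<in>N. sum (q \<beta>) C = 1 \<and> (\<Sum>\<mu>\<in>C. q \<beta> \<mu> *\<^sub>R \<mu>) = \<beta> \<and>
      (\<forall>v. (\<Sum>\<mu>\<in>C. q \<beta> \<mu> * exp (\<mu> \<bullet> v)) \<le> exp (\<beta> \<bullet> v))" ..
  then have q: "\<And>\<beta>. \<beta> \<in> N \<Longrightarrow> sum (q \<beta>) C = 1"
      "\<And>\<beta>. \<beta> \<in> N \<Longrightarrow> (\<Sum>\<mu>\<in>C. q \<beta> \<mu> *\<^sub>R \<mu>) = \<beta>"
      "\<And>\<beta> v. \<beta> \<in> N \<Longrightarrow> (\<Sum>\<mu>\<in>C. q \<beta> \<mu> * exp (\<mu> \<bullet> v)) \<le> exp (\<beta> \<bullet> v)"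
    by blast+
  show ?thesis
    unfolding exp_dominated_def
  proof (intro allI impI)
    fix k :: "real^'n \<Rightarrow> real" and v
    assume k: "\<forall>\<alpha>\<in>P. 0 \<le> k \<alpha>" "\<forall>\<beta>\<in>N. 0 \<le> k \<beta>" "sum k P = 1" "sum k N = 1"
      and bary: "(\<Sum>\<alpha>\<in>P. k \<alpha> *\<^sub>R \<alpha>) = (\<Sum>\<beta>\<in>N. k \<beta> *\<^sub>R \<beta>)"
    define K where "K = (\<lambda>\<mu>. (\<Sum>\<alpha>\<in>P. k \<alpha> * p \<alpha> \<mu>) - (\<Sum>\<beta>\<in>N. k \<beta> * q \<beta> \<mu>))"
    have swap: "(\<Sum>\<mu>\<in>C. K \<mu> *\<^sub>R f \<mu>)
        = (\<Sum>\<alpha>\<in>P. k \<alpha> *\<^sub>R (\<Sum>\<mu>\<in>C. p \<alpha> \<mu> *\<^sub>R f \<mu>)) - (\<Sum>\<beta>\<in>N. k \<beta> *\<^sub>R (\<Sum>\<mu>\<in>C. q \<beta> \<mu> *\<^sub>R f \<mu>))"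
      for f :: "real^'n \<Rightarrow> 'b::real_vector"
      by (simp add: K_def scaleR_diff_left sum_subtractf scaleR_sum_left scaleR_sum_right
          sum.swap[of _ C])
    have "sum K C = 0" using swap[of "\<lambda>_. 1::real"] k p(1) q(1) by simp
    moreover have "(\<Sum>\<mu>\<in>C. K \<mu> *\<^sub>R \<mu>) = 0" using swap[of "\<lambda>\<mu>. \<mu>"] bary p(2) q(2) by simp
    ultimately have "\<forall>\<mu>\<in>C. K \<mu> = 0"
      using C(1) affine_dependent_explicit_finite[OF fin] by blast
    then have "(\<Sum>\<mu>\<in>C. K \<mu> *\<^sub>R exp (\<mu> \<bullet> v)) = 0" by simp
    then have eq: "(\<Sum>\<alpha>\<in>P. k \<alpha> * (\<Sum>\<mu>\<in>C. p \<alpha> \<mu> * exp (\<mu> \<bullet> v)))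
        = (\<Sum>\<beta>\<in>N. k \<beta> * (\<Sum>\<mu>\<in>C. q \<beta> \<mu> * exp (\<mu> \<bullet> v)))"
      using swap[of "\<lambda>\<mu>. exp (\<mu> \<bullet> v)"] by simp
    have "exp_sum P k v \<le> (\<Sum>\<alpha>\<in>P. k \<alpha> * (\<Sum>\<mu>\<in>C. p \<alpha> \<mu> * exp (\<mu> \<bullet> v)))"
      unfolding exp_sum_def using k p(3) by (intro sum_mono mult_left_mono) auto
    also note eq
    also have "(\<Sum>\<beta>\<in>N. k \<beta> * (\<Sum>\<mu>\<in>C. q \<beta> \<mu> * exp (\<mu> \<bullet> v))) \<le> exp_sum N k v"
      unfolding exp_sum_def using k q(3) by (intro sum_mono mult_left_mono) auto
    finally show "exp_sum P k v \<le> exp_sum N k v" .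
  qed
qed

section \<open>No critical points at infinity\<close>

lemma common_convergent_subsequence:
  fixes w :: "'a \<Rightarrow> nat \<Rightarrow> real"
  assumes "finite A" and "\<And>a m. a \<in> A \<Longrightarrow> w a m \<in> {0..1}"
  shows "\<exists>r W. strict_mono r \<and> (\<forall>a\<in>A. (\<lambda>m. w a (r m)) \<longlonglongrightarrow> W a)"
  using assms
proof (induction A)
  case empty
  have "strict_mono (id :: nat \<Rightarrow> nat)" by (simp add: strict_mono_def)
  then show ?case by auto
next
  case (insert a A)
  then obtain r W where r: "strict_mono (r :: nat \<Rightarrow> nat)" and W: "\<forall>a\<in>A. (\<lambda>m. w a (r m)) \<longlonglongrightarrow> W a"
    by auto
  have "seq_compact {0..1::real}" by (simp add: compact_imp_seq_compact)
  moreover have "\<forall>m. w a (r m) \<in> {0..1}" using insert.prems by blast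
  ultimately obtain l r' where r': "strict_mono r'" and l: "((\<lambda>m. w a (r m)) \<circ> r') \<longlonglongrightarrow> l"
    unfolding seq_compact_def by metis
  have "(\<lambda>m. w b ((r \<circ> r') m)) \<longlonglongrightarrow> (W(a := l)) b" if "b \<in> insert a A" for b
  proof (cases "b = a")
    case True then show ?thesis using l by (simp add: o_def)
  next
    case False
    then have "(\<lambda>m. w b (r m)) \<longlonglongrightarrow> W b" using that W by simp
    from LIMSEQ_subseq_LIMSEQ[OF this r'] show ?thesis using False by (simp add: o_def)
  qed
  moreover have "strict_mono (r \<circ> r')" by (rule strict_mono_o[OF r r'])
  ultimately show ?case by blast
qed

context
  fixes A :: "(real^'n) set" and d :: "real^'n \<Rightarrow> real" and x :: "nat \<Rightarrow> real^'n" and W :: "real^'n \<Rightarrow> real"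
  assumes fin: "finite A" and ne: "A \<noteq> {}" and d_pos: "\<And>a. a \<in> A \<Longrightarrow> 0 < d a"
    and lim: "\<And>a. a \<in> A \<Longrightarrow> (\<lambda>m. d a * exp (a \<bullet> x m) / exp_sum A d (x m)) \<longlonglongrightarrow> W a"
begin

lemma weight_bounds:
  assumes "a \<in> A"
  shows "0 < d a * exp (a \<bullet> y) / exp_sum A d y" "d a * exp (a \<bullet> y) / exp_sum A d y \<le> 1"
proof -
  have pos: "0 < exp_sum A d y" using fin ne d_pos by (rule exp_sum_pos)
  then show "0 < d a * exp (a \<bullet> y) / exp_sum A d y" using d_pos[OF assms] by simp
  have "d a * exp (a \<bullet> y) \<le> exp_sum A d y"
    unfolding exp_sum_def using fin assms d_pos by (intro member_le_sum) (auto simp: less_imp_le)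
  then show "d a * exp (a \<bullet> y) / exp_sum A d y \<le> 1" using pos by simp
qed

text \<open>
  If two convex combinations of the exponents agree, then the corresponding weighted geometric means of
  the weights differ by a constant factor. A combination supported on exponents with positive limit
  weight keeps this product away from \<open>0\<close>, hence no exponent used by the other combination can lose all
  its weight.
\<close>
lemma limit_support_absorbs:
  assumes t: "\<And>b. b \<in> A \<Longrightarrow> t b \<noteq> 0 \<Longrightarrow> 0 < W b" "sum t A = 1"
    and s: "\<And>b. b \<in> A \<Longrightarrow> 0 \<le> s b" "sum s A = 1"
    and same: "(\<Sum>b\<in>A. t b *\<^sub>R b) = (\<Sum>b\<in>A. s b *\<^sub>R b)"
    and a: "a \<in> A" "0 < s a"
  shows "0 < W a"
proof -
  define w where "w = (\<lambda>b m. d b * exp (b \<bullet> x m) / exp_sum A d (x m))"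
  have w: "0 < w b m" "w b m \<le> 1" if "b \<in> A" for b m
    using weight_bounds[OF that] by (auto simp: w_def)
  have ln_w: "ln (w b m) = ln (d b) + b \<bullet> x m - ln (exp_sum A d (x m))" if "b \<in> A" for b m
    using d_pos[OF that] exp_sum_pos[of A d "x m"] fin ne d_pos by (simp add: w_def ln_div ln_mult)
  have expand: "(\<Sum>b\<in>A. u b * ln (w b m))
      = (\<Sum>b\<in>A. u b * ln (d b)) + (\<Sum>b\<in>A. u b *\<^sub>R b) \<bullet> x m - sum u A * ln (exp_sum A d (x m))" for u m
  proof -
    have "(\<Sum>b\<in>A. u b * ln (w b m)) = (\<Sum>b\<in>A. u b * ln (d b) + u b * (b \<bullet> x m) - u b * ln (exp_sum A d (x m)))"
      by (intro sum.cong) (auto simp: ln_w algebra_simps)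
    then show ?thesis by (simp add: sum.distrib sum_subtractf inner_sum_left sum_distrib_right)
  qed
  define Q where "Q = (\<Sum>b\<in>A. t b * ln (W b)) + ((\<Sum>b\<in>A. s b * ln (d b)) - (\<Sum>b\<in>A. t b * ln (d b)))"
  have "(\<lambda>m. \<Sum>b\<in>A. t b * ln (w b m)) \<longlonglongrightarrow> (\<Sum>b\<in>A. t b * ln (W b))"
  proof (intro tendsto_sum)
    fix b assume b: "b \<in> A"
    show "(\<lambda>m. t b * ln (w b m)) \<longlonglongrightarrow> t b * ln (W b)"
    proof (cases "t b = 0")
      case False
      then show ?thesis using t(1)[OF b] lim[OF b] by (intro tendsto_intros) (auto simp: w_def)
    qed simp
  qed
  moreover have "(\<Sum>b\<in>A. s b * ln (w b m)) = (\<Sum>b\<in>A. t b * ln (w b m))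
      + ((\<Sum>b\<in>A. s b * ln (d b)) - (\<Sum>b\<in>A. t b * ln (d b)))" for m
    using t(2) s(2) same by (simp add: expand)
  ultimately have "(\<lambda>m. \<Sum>b\<in>A. s b * ln (w b m)) \<longlonglongrightarrow> Q"
    unfolding Q_def by (simp add: tendsto_add)
  then have "(\<lambda>m. exp ((\<Sum>b\<in>A. s b * ln (w b m)) / s a)) \<longlonglongrightarrow> exp (Q / s a)"
    using a by (intro tendsto_intros) auto
  moreover have "exp ((\<Sum>b\<in>A. s b * ln (w b m)) / s a) \<le> w a m" for m
  proof -
    have "(\<Sum>b\<in>A. s b * ln (w b m)) = s a * ln (w a m) + (\<Sum>b\<in>A - {a}. s b * ln (w b m))"
      using fin a by (simp add: sum.remove)
    also have "(\<Sum>b\<in>A - {a}. s b * ln (w b m)) \<le> 0"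
      using s w by (intro sum_nonpos mult_nonneg_nonpos) (auto simp: ln_le_zero_iff)
    finally have "(\<Sum>b\<in>A. s b * ln (w b m)) / s a \<le> ln (w a m)" using a by (simp add: field_simps)
    then have "exp ((\<Sum>b\<in>A. s b * ln (w b m)) / s a) \<le> exp (ln (w a m))" by simp
    then show ?thesis using w(1)[OF a(1)] by simp
  qed
  moreover have "(\<lambda>m. w a m) \<longlonglongrightarrow> W a" unfolding w_def by (rule lim[OF a(1)])
  ultimately have "exp (Q / s a) \<le> W a" by (blast intro: LIMSEQ_le)
  then show ?thesis using exp_gt_zero order_less_le_trans by blast
qed

lemma convex_combination_in_support_hull:
  assumes "\<And>a. a \<in> A \<Longrightarrow> 0 \<le> s a" "sum s A = 1" and supp: "\<And>a. a \<in> A \<Longrightarrow> 0 < s a \<Longrightarrow> 0 < W a"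
  shows "(\<Sum>a\<in>A. s a *\<^sub>R a) \<in> convex hull {a\<in>A. 0 < W a}"
proof -
  let ?B = "{a\<in>A. 0 < W a}"
  have off: "s a = 0" if "a \<in> A - ?B" for a
    using that assms(1)[of a] supp[of a] by fastforce
  have "sum s A = sum s ?B" "(\<Sum>a\<in>A. s a *\<^sub>R a) = (\<Sum>a\<in>?B. s a *\<^sub>R a)"
    using off by (intro sum.mono_neutral_right fin; auto)+
  then show ?thesis using assms fin by (auto simp: convex_hull_finite intro!: exI[of _ s])
qed

lemma support_hull_combination:
  assumes "z \<in> convex hull {a\<in>A. 0 < W a}"
  obtains t where "\<And>b. b \<in> A \<Longrightarrow> t b \<noteq> 0 \<Longrightarrow> 0 < W b" "sum t A = 1" "(\<Sum>b\<in>A. t b *\<^sub>R b) = z"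
proof -
  let ?B = "{a\<in>A. 0 < W a}"
  have "finite ?B" using fin by simp
  with assms obtain u where u: "sum u ?B = 1" "(\<Sum>b\<in>?B. u b *\<^sub>R b) = z"
    by (auto simp: convex_hull_finite)
  define t where "t = (\<lambda>b. if 0 < W b then u b else 0)"
  have "sum t A = sum u ?B" "(\<Sum>b\<in>A. t b *\<^sub>R b) = (\<Sum>b\<in>?B. u b *\<^sub>R b)"
    by (intro sum.mono_neutral_cong_right fin; auto simp: t_def)+
  then show ?thesis using u by (intro that[of t]) (auto simp: t_def split: if_splits)
qed

text \<open>
  This is the compactification of the family of weights by the faces of the convex hull: along a sequence whose weights
  converge, the surviving exponents are those of a face.
\<close>
lemma limit_support_face: "convex hull {a\<in>A. 0 < W a} face_of convex hull A"
proof -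
  let ?B = "{a\<in>A. 0 < W a}"
  have "p \<in> convex hull ?B \<and> q \<in> convex hull ?B"
    if p: "p \<in> convex hull A" and q: "q \<in> convex hull A" and z: "z \<in> convex hull ?B" "z \<in> open_segment p q"
    for p q z
  proof -
    obtain t where t: "\<And>b. b \<in> A \<Longrightarrow> t b \<noteq> 0 \<Longrightarrow> 0 < W b" "sum t A = 1" "(\<Sum>b\<in>A. t b *\<^sub>R b) = z"
      using support_hull_combination[OF z(1)] by blast
    obtain u where u: "0 < u" "u < 1" "z = (1 - u) *\<^sub>R p + u *\<^sub>R q"
      using z(2) by (auto simp: in_segment)
    obtain sp where sp: "\<And>a. a \<in> A \<Longrightarrow> 0 \<le> sp a" "sum sp A = 1" "(\<Sum>a\<in>A. sp a *\<^sub>R a) = p"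
      using p by (auto simp: convex_hull_finite fin)
    obtain sq where sq: "\<And>a. a \<in> A \<Longrightarrow> 0 \<le> sq a" "sum sq A = 1" "(\<Sum>a\<in>A. sq a *\<^sub>R a) = q"
      using q by (auto simp: convex_hull_finite fin)
    \<comment> \<open>A combination for \<open>z\<close> that uses every exponent occurring in those for \<open>p\<close> and \<open>q\<close>.\<close>
    define s where "s = (\<lambda>a. (1 - u) * sp a + u * sq a)"
    have s: "\<And>a. a \<in> A \<Longrightarrow> 0 \<le> s a" "sum s A = 1" "(\<Sum>a\<in>A. s a *\<^sub>R a) = z"
    proof -
      show "0 \<le> s a" if "a \<in> A" for a using sp(1)[OF that] sq(1)[OF that] u by (simp add: s_def)
      show "sum s A = 1" using sp(2) sq(2) by (simp add: s_def sum.distrib sum_distrib_left[symmetric])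
      have "(\<Sum>a\<in>A. s a *\<^sub>R a) = (1 - u) *\<^sub>R (\<Sum>a\<in>A. sp a *\<^sub>R a) + u *\<^sub>R (\<Sum>a\<in>A. sq a *\<^sub>R a)"
        by (simp add: s_def scaleR_sum_right scaleR_left_distrib sum.distrib)
      then show "(\<Sum>a\<in>A. s a *\<^sub>R a) = z" using sp(3) sq(3) u(3) by simp
    qed
    have W: "0 < W a" if "a \<in> A" "0 < sp a \<or> 0 < sq a" for a
    proof -
      have "0 < s a"
        using that sp(1)[OF that(1)] sq(1)[OF that(1)] u
        unfolding s_def by (auto intro: add_pos_nonneg add_nonneg_pos)
      then show ?thesis
        using limit_support_absorbs[OF t(1,2) s(1,2) _ that(1)] t(3) s(3) by simp
    qed
    show ?thesis
      using convex_combination_in_support_hull[OF sp(1,2)] convex_combination_in_support_hull[OF sq(1,2)] W sp(3) sq(3)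
      by blast
  qed
  moreover have "convex hull ?B \<subseteq> convex hull A" by (intro hull_mono) blast
  ultimately show ?thesis unfolding face_of_def by (meson convex_convex_hull)
qed

lemma limit_support_hull_Int: "A \<inter> convex hull {a\<in>A. 0 < W a} = {a\<in>A. 0 < W a}"
proof (intro equalityI subsetI)
  fix a assume a: "a \<in> A \<inter> convex hull {a\<in>A. 0 < W a}"
  then obtain t where t: "\<And>b. b \<in> A \<Longrightarrow> t b \<noteq> 0 \<Longrightarrow> 0 < W b" "sum t A = 1" "(\<Sum>b\<in>A. t b *\<^sub>R b) = a"
    using support_hull_combination by blast
  define s where "s = (\<lambda>b. if b = a then 1 else 0 :: real)"
  have "sum s A = 1" "(\<Sum>b\<in>A. s b *\<^sub>R b) = a"
    using a fin by (simp_all add: s_def if_distrib[of "\<lambda>c. c *\<^sub>R _"] cong: if_cong)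
  then show "a \<in> {a\<in>A. 0 < W a}"
    using limit_support_absorbs[OF t(1,2), of s a] t(3) a by (auto simp: s_def)
qed (auto intro: hull_inc)

end

text \<open>
  Otherwise there are points of the band along which the gradient tends to \<open>0\<close>, and their weights may be
  assumed to converge. The band keeps both signs present in the limit, where the two means must agree.
  If the surviving exponents are those of a proper face, a nontrivial separating hyperplane
  makes the two means differ. If all exponents survive, full dimension forces the points to
  converge, and the limit is a critical point in the band.
\<close>
lemma log_ratio_grad_bounded_below:
  fixes P N :: "(real^'n) set"
  assumes fin: "finite P" "finite N" and ne: "P \<noteq> {}" "N \<noteq> {}" and disj: "P \<inter> N = {}"
    and d_pos: "\<And>\<beta>. \<beta> \<in> P \<union> N \<Longrightarrow> 0 < d \<beta>"
    and full: "affine hull (P \<union> N) = UNIV"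
    and faces: "\<And>F. F face_of convex hull (P \<union> N) \<Longrightarrow> F \<noteq> {} \<Longrightarrow> F \<noteq> convex hull (P \<union> N) \<Longrightarrow>
      \<exists>v c. (\<forall>\<alpha>\<in>P \<inter> F. c \<le> \<alpha> \<bullet> v) \<and> (\<forall>\<beta>\<in>N \<inter> F. \<beta> \<bullet> v \<le> c) \<and> (\<exists>\<mu>\<in>(P \<union> N) \<inter> F. \<mu> \<bullet> v \<noteq> c)"
    and regular: "\<And>x. a \<le> log_ratio P N d x \<Longrightarrow> log_ratio P N d x \<le> b \<Longrightarrow> log_ratio_grad P N d x \<noteq> 0"
  shows "\<exists>\<delta>>0. \<forall>x. a \<le> log_ratio P N d x \<longrightarrow> log_ratio P N d x \<le> b \<longrightarrow> \<delta> \<le> norm (log_ratio_grad P N d x)"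
proof (rule ccontr)
  let ?\<Psi> = "log_ratio P N d" and ?g = "log_ratio_grad P N d" and ?A = "P \<union> N"
  assume neg: "\<not> ?thesis"
  have "\<exists>x. a \<le> ?\<Psi> x \<and> ?\<Psi> x \<le> b \<and> norm (?g x) < inverse (real (Suc m))" for m
    using neg by (metis inverse_positive_iff_positive not_le of_nat_0_less_iff zero_less_Suc)
  then obtain y where y: "\<And>m. a \<le> ?\<Psi> (y m)" "\<And>m. ?\<Psi> (y m) \<le> b"
      "\<And>m. norm (?g (y m)) < inverse (real (Suc m))" by metis
  have A: "finite ?A" "?A \<noteq> {}" using fin ne by auto
  have posA: "0 < exp_sum ?A d z" for z using A d_pos by (rule exp_sum_pos)
  have posP: "0 < exp_sum P d z" and posN: "0 < exp_sum N d z" for z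
    using fin ne d_pos by (auto intro!: exp_sum_pos)
  have wb: "d \<beta> * exp (\<beta> \<bullet> z) / exp_sum ?A d z \<in> {0..1}" if "\<beta> \<in> ?A" for \<beta> z
  proof -
    have "d \<beta> * exp (\<beta> \<bullet> z) \<le> exp_sum ?A d z"
      unfolding exp_sum_def using A that d_pos by (intro member_le_sum) (auto simp: less_imp_le)
    then show ?thesis using posA[of z] d_pos[OF that] by simp
  qed
  obtain r W where r: "strict_mono (r :: nat \<Rightarrow> nat)"
    and lim_r: "\<forall>\<beta>\<in>?A. (\<lambda>m. d \<beta> * exp (\<beta> \<bullet> y (r m)) / exp_sum ?A d (y (r m))) \<longlonglongrightarrow> W \<beta>"
    using common_convergent_subsequence[where A = ?A and w = "\<lambda>\<beta> m. d \<beta> * exp (\<beta> \<bullet> y m) / exp_sum ?A d (y m)",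
        OF A(1) wb] by blast
  define x where "x = y \<circ> r"
  define w where "w = (\<lambda>\<beta> m. d \<beta> * exp (\<beta> \<bullet> x m) / exp_sum ?A d (x m))"
  have lim: "(\<lambda>m. d \<beta> * exp (\<beta> \<bullet> x m) / exp_sum ?A d (x m)) \<longlonglongrightarrow> W \<beta>" if "\<beta> \<in> ?A" for \<beta>
    using lim_r that by (simp add: x_def)
  then have w_lim: "(\<lambda>m. w \<beta> m) \<longlonglongrightarrow> W \<beta>" if "\<beta> \<in> ?A" for \<beta> using that by (simp add: w_def)
  have w_pos: "0 < w \<beta> m" if "\<beta> \<in> ?A" for \<beta> m using posA d_pos[OF that] by (simp add: w_def)
  have x_band: "a \<le> ?\<Psi> (x m)" "?\<Psi> (x m) \<le> b" for m using y by (auto simp: x_def)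
  have g_lim: "(\<lambda>m. ?g (x m)) \<longlonglongrightarrow> 0"
  proof -
    have "(\<lambda>m. ?g (y m)) \<longlonglongrightarrow> 0"
      by (rule Lim_null_comparison[OF _ LIMSEQ_inverse_real_of_nat]) (use y(3) in \<open>auto intro!: always_eventually less_imp_le\<close>)
    from LIMSEQ_subseq_LIMSEQ[OF this r] show ?thesis by (simp add: x_def o_def)
  qed
  have W0: "0 \<le> W \<beta>" if "\<beta> \<in> ?A" for \<beta>
    using w_lim[OF that] w_pos[OF that] by (intro LIMSEQ_le_const) (auto simp: less_imp_le)
  have share: "sum (\<lambda>\<beta>. w \<beta> m) B = exp_sum B d (x m) / exp_sum ?A d (x m)" for B m
    by (simp add: w_def exp_sum_def sum_divide_distrib)
  have limP: "(\<lambda>m. sum (\<lambda>\<beta>. w \<beta> m) P) \<longlonglongrightarrow> sum W P" and limN: "(\<lambda>m. sum (\<lambda>\<beta>. w \<beta> m) N) \<longlonglongrightarrow> sum W N"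
    using w_lim by (auto intro!: tendsto_sum)
  have shareP: "0 < sum (\<lambda>\<beta>. w \<beta> m) P" and shareN: "0 < sum (\<lambda>\<beta>. w \<beta> m) N" for m
    using posP posN posA by (auto simp: share)
  have total: "sum (\<lambda>\<beta>. w \<beta> m) P + sum (\<lambda>\<beta>. w \<beta> m) N = 1" for m
  proof -
    have "exp_sum ?A d (x m) = exp_sum P d (x m) + exp_sum N d (x m)"
      unfolding exp_sum_def using fin disj by (intro sum.union_disjoint)
    then show ?thesis using posA[of "x m"] by (simp add: share add_divide_distrib[symmetric])
  qed
  have "(\<lambda>m. sum (\<lambda>\<beta>. w \<beta> m) P + sum (\<lambda>\<beta>. w \<beta> m) N) \<longlonglongrightarrow> sum W P + sum W N"
    by (intro tendsto_add limP limN)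
  then have total_W: "sum W P + sum W N = 1" unfolding total by (simp add: LIMSEQ_const_iff)
  have ratio: "sum (\<lambda>\<beta>. w \<beta> m) N = exp (?\<Psi> (x m)) * sum (\<lambda>\<beta>. w \<beta> m) P" for m
    using posP[of "x m"] posN[of "x m"] by (simp add: share log_ratio_def exp_diff)
  have low: "exp a * sum W P \<le> sum W N"
  proof (rule LIMSEQ_le[OF tendsto_mult_left[OF limP] limN])
    show "\<exists>M. \<forall>m\<ge>M. exp a * sum (\<lambda>\<beta>. w \<beta> m) P \<le> sum (\<lambda>\<beta>. w \<beta> m) N"
      unfolding ratio using x_band(1) shareP by (intro exI[of _ 0] allI impI mult_right_mono) (auto simp: less_imp_le)
  qed
  have high: "sum W N \<le> exp b * sum W P"
  proof (rule LIMSEQ_le[OF limN tendsto_mult_left[OF limP]])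
    show "\<exists>M. \<forall>m\<ge>M. sum (\<lambda>\<beta>. w \<beta> m) N \<le> exp b * sum (\<lambda>\<beta>. w \<beta> m) P"
      unfolding ratio using x_band(2) shareP by (intro exI[of _ 0] allI impI mult_right_mono) (auto simp: less_imp_le)
  qed
  have nonneg: "0 \<le> sum W P" "0 \<le> sum W N" using W0 by (auto intro!: sum_nonneg)
  have "sum W P \<noteq> 0"
  proof
    assume "sum W P = 0"
    with high total_W show False by simp
  qed
  then have WP: "0 < sum W P" using nonneg by simp
  then have "0 < exp a * sum W P" by simp
  then have WN: "0 < sum W N" using low by linarith
  let ?B = "{\<beta>\<in>?A. 0 < W \<beta>}"
  have "?B \<noteq> {}"
  proof
    assume "?B = {}"
    then have "sum W P \<le> 0" by (intro sum_nonpos) (auto simp: not_less)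
    then show False using WP by simp
  qed
  have face: "convex hull ?B face_of convex hull ?A" and hull_Int: "?A \<inter> convex hull ?B = ?B"
    using limit_support_face[OF A d_pos lim] limit_support_hull_Int[OF A d_pos lim] by auto
  show False
  proof (cases "convex hull ?B = convex hull ?A")
    case False
    then obtain v c where v: "\<forall>\<alpha>\<in>P \<inter> convex hull ?B. c \<le> \<alpha> \<bullet> v" "\<forall>\<beta>\<in>N \<inter> convex hull ?B. \<beta> \<bullet> v \<le> c"
        "\<exists>\<mu>\<in>?A \<inter> convex hull ?B. \<mu> \<bullet> v \<noteq> c"
      using faces[OF face] \<open>?B \<noteq> {}\<close> by auto
    have mean: "weighted_mean B d (x m) \<bullet> v - c = (\<Sum>\<beta>\<in>B. w \<beta> m * (\<beta> \<bullet> v - c)) / sum (\<lambda>\<beta>. w \<beta> m) B"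
      if "B = P \<or> B = N" for B m
    proof -
      have "weighted_mean B d (x m) \<bullet> v - c = (\<Sum>\<beta>\<in>B. d \<beta> * exp (\<beta> \<bullet> x m) * (\<beta> \<bullet> v - c)) / exp_sum B d (x m)"
        using that fin ne d_pos by (intro weighted_mean_inner_shift) auto
      also have "\<dots> = ((\<Sum>\<beta>\<in>B. d \<beta> * exp (\<beta> \<bullet> x m) * (\<beta> \<bullet> v - c)) / exp_sum ?A d (x m)) / sum (\<lambda>\<beta>. w \<beta> m) B"
        using posA[of "x m"] by (simp add: share)
      finally show ?thesis by (simp add: w_def sum_divide_distrib)
    qed
    have "(\<lambda>m. (\<Sum>\<beta>\<in>N. w \<beta> m * (\<beta> \<bullet> v - c)) / sum (\<lambda>\<beta>. w \<beta> m) N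
          - (\<Sum>\<beta>\<in>P. w \<beta> m * (\<beta> \<bullet> v - c)) / sum (\<lambda>\<beta>. w \<beta> m) P)
        \<longlonglongrightarrow> (\<Sum>\<beta>\<in>N. W \<beta> * (\<beta> \<bullet> v - c)) / sum W N - (\<Sum>\<beta>\<in>P. W \<beta> * (\<beta> \<bullet> v - c)) / sum W P"
      using WP WN by (intro tendsto_intros limP limN w_lim) auto
    moreover have "(\<Sum>\<beta>\<in>N. w \<beta> m * (\<beta> \<bullet> v - c)) / sum (\<lambda>\<beta>. w \<beta> m) N
          - (\<Sum>\<beta>\<in>P. w \<beta> m * (\<beta> \<bullet> v - c)) / sum (\<lambda>\<beta>. w \<beta> m) P = ?g (x m) \<bullet> v" for m
      using mean[of N m] mean[of P m] by (simp add: log_ratio_grad_def inner_diff_left)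
    moreover have "(\<lambda>m. ?g (x m) \<bullet> v) \<longlonglongrightarrow> 0" using tendsto_inner[OF g_lim tendsto_const, of v] by simp
    ultimately have balance: "(\<Sum>\<beta>\<in>N. W \<beta> * (\<beta> \<bullet> v - c)) / sum W N = (\<Sum>\<beta>\<in>P. W \<beta> * (\<beta> \<bullet> v - c)) / sum W P"
      using LIMSEQ_unique by fastforce
    have termP: "0 \<le> W \<beta> * (\<beta> \<bullet> v - c)" if "\<beta> \<in> P" for \<beta>
    proof (cases "0 < W \<beta>")
      case True
      then have "c \<le> \<beta> \<bullet> v" using that v(1) hull_Int by blast
      then show ?thesis using True by simp
    next
      case False then show ?thesis using W0[of \<beta>] that by simp
    qed
    have termN: "0 \<le> - (W \<beta> * (\<beta> \<bullet> v - c))" if "\<beta> \<in> N" for \<beta>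
    proof (cases "0 < W \<beta>")
      case True
      then have "\<beta> \<bullet> v \<le> c" using that v(2) hull_Int by blast
      then show ?thesis using True by (simp add: mult_le_0_iff)
    next
      case False then show ?thesis using W0[of \<beta>] that by simp
    qed
    define SP SN where "SP = (\<Sum>\<beta>\<in>P. W \<beta> * (\<beta> \<bullet> v - c))" and "SN = (\<Sum>\<beta>\<in>N. - (W \<beta> * (\<beta> \<bullet> v - c)))"
    have "0 \<le> SP" unfolding SP_def using termP by (rule sum_nonneg)
    have "0 \<le> SN" unfolding SN_def using termN by (rule sum_nonneg)
    have "- (SN / sum W N) = SP / sum W P" using balance by (simp add: SP_def SN_def sum_negf)
    moreover have "0 \<le> SN / sum W N" "0 \<le> SP / sum W P"
      using \<open>0 \<le> SP\<close> \<open>0 \<le> SN\<close> WP WN by (simp_all add: divide_nonneg_pos)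
    ultimately have "SP / sum W P = 0" "SN / sum W N = 0" by linarith+
    then have "SP = 0" "SN = 0" using WP WN by simp_all
    then have "\<forall>\<beta>\<in>P. W \<beta> * (\<beta> \<bullet> v - c) = 0" "\<forall>\<beta>\<in>N. - (W \<beta> * (\<beta> \<bullet> v - c)) = 0"
      using sum_nonneg_eq_0_iff[OF fin(1) termP] sum_nonneg_eq_0_iff[OF fin(2) termN]
      by (simp_all only: SP_def SN_def)
    then have "\<mu> \<bullet> v = c" if "\<mu> \<in> ?B" for \<mu> using that by fastforce
    then show False using v(3) hull_Int by blast
  next
    case True
    then have B: "?B = ?A" using hull_Int hull_subset[of ?A convex] by blast
    have Wpos: "0 < W \<beta>" if "\<beta> \<in> ?A" for \<beta> using that B by blast
    have conv_diff: "convergent (\<lambda>m. (\<beta> - \<gamma>) \<bullet> x m)" if "\<beta> \<in> ?A" "\<gamma> \<in> ?A" for \<beta> \<gamma>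
    proof -
      have "(\<beta> - \<gamma>) \<bullet> x m = ln (w \<beta> m) - ln (w \<gamma> m) - ln (d \<beta>) + ln (d \<gamma>)" for m
        using posA[of "x m"] d_pos[OF that(1)] d_pos[OF that(2)]
        by (simp add: w_def ln_div ln_mult inner_diff_left)
      moreover have "(\<lambda>m. ln (w \<beta> m) - ln (w \<gamma> m) - ln (d \<beta>) + ln (d \<gamma>))
          \<longlonglongrightarrow> ln (W \<beta>) - ln (W \<gamma>) - ln (d \<beta>) + ln (d \<gamma>)"
        using that Wpos[OF that(1)] Wpos[OF that(2)] by (intro tendsto_intros w_lim) auto
      ultimately show ?thesis unfolding convergent_def by auto
    qed
    obtain \<gamma> where \<gamma>: "\<gamma> \<in> ?A" using A by blast
    have "subspace {u. convergent (\<lambda>m. u \<bullet> x m)}"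
      by (auto simp: subspace_def inner_add_left convergent_const intro: convergent_add convergent_mult_const_iff
          convergent_mult[OF convergent_const])
    moreover have "(\<lambda>\<beta>. - \<gamma> + \<beta>) ` (?A - {\<gamma>}) \<subseteq> {u. convergent (\<lambda>m. u \<bullet> x m)}"
      using conv_diff[OF _ \<gamma>] by auto
    ultimately have "span ((\<lambda>\<beta>. - \<gamma> + \<beta>) ` (?A - {\<gamma>})) \<subseteq> {u. convergent (\<lambda>m. u \<bullet> x m)}"
      by (rule span_minimal[rotated])
    moreover have "u \<in> span ((\<lambda>\<beta>. - \<gamma> + \<beta>) ` (?A - {\<gamma>}))" for u
    proof -
      have "\<gamma> + u \<in> (\<lambda>z. \<gamma> + z) ` span ((\<lambda>\<beta>. - \<gamma> + \<beta>) ` (?A - {\<gamma>}))"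
        using affine_hull_span2[OF \<gamma>] full by simp
      then show ?thesis by auto
    qed
    ultimately have conv: "convergent (\<lambda>m. u \<bullet> x m)" for u by blast
    define z where "z = (\<Sum>u\<in>Basis. lim (\<lambda>m. u \<bullet> x m) *\<^sub>R u)"
    have "(\<lambda>m. \<Sum>u\<in>Basis. (u \<bullet> x m) *\<^sub>R u) \<longlonglongrightarrow> z"
      unfolding z_def by (intro tendsto_intros) (use conv convergent_LIMSEQ_iff in blast)
    then have xz: "x \<longlonglongrightarrow> z" by (simp add: inner_commute[of _ "x _"] euclidean_representation)
    have deriv: "(?\<Psi> has_derivative (\<lambda>h. ?g z \<bullet> h)) (at z)"
      using fin ne d_pos by (intro log_ratio_has_derivative) auto
    have "(\<lambda>m. ?\<Psi> (x m)) \<longlonglongrightarrow> ?\<Psi> z"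
      by (rule isCont_tendsto_compose[OF has_derivative_continuous[OF deriv] xz])
    then have "a \<le> ?\<Psi> z" "?\<Psi> z \<le> b"
      using x_band by (auto intro: LIMSEQ_le_const LIMSEQ_le_const2)
    moreover have "?g z = 0"
    proof -
      have "isCont ?g z"
        unfolding log_ratio_grad_def weighted_mean_def
        using posP posN continuous_on_exp_sum[of UNIV P d] continuous_on_exp_sum[of UNIV N d]
        by (intro continuous_intros) (auto simp: continuous_on_eq_continuous_at less_imp_neq[symmetric])
      from isCont_tendsto_compose[OF this xz] g_lim show ?thesis using LIMSEQ_unique by blast
    qed
    ultimately show False using regular by blast
  qed
qed

section \<open>Large levels and support functions\<close>

definition support_function :: "(real^'n) set \<Rightarrow> real^'n \<Rightarrow> real" where
  "support_function B v = (MAX \<beta>\<in>B. v \<bullet> \<beta>)"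

lemma support_function_ge:
  assumes "finite B" "\<beta> \<in> B"
  shows "v \<bullet> \<beta> \<le> support_function B v"
  using assms by (simp add: support_function_def)

lemma support_function_attained:
  assumes "finite B" "B \<noteq> {}"
  obtains \<beta> where "\<beta> \<in> B" "support_function B v = v \<bullet> \<beta>"
proof -
  have "(MAX \<beta>\<in>B. v \<bullet> \<beta>) \<in> (\<lambda>\<beta>. v \<bullet> \<beta>) ` B" using assms by (intro Max_in) auto
  then show ?thesis using that by (auto simp: support_function_def)
qed

lemma support_function_scaleR:
  assumes B: "finite B" "B \<noteq> {}" and "0 \<le> r"
  shows "support_function B (r *\<^sub>R v) = r * support_function B v"
proof -
  obtain \<beta> where \<beta>: "\<beta> \<in> B" "support_function B v = v \<bullet> \<beta>"
    using support_function_attained[OF B] by blast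
  have "(MAX \<gamma>\<in>B. r *\<^sub>R v \<bullet> \<gamma>) = r *\<^sub>R v \<bullet> \<beta>"
  proof (rule Max_eqI)
    fix y assume "y \<in> (\<lambda>\<gamma>. r *\<^sub>R v \<bullet> \<gamma>) ` B"
    then obtain \<gamma> where "\<gamma> \<in> B" "y = r * (v \<bullet> \<gamma>)" by auto
    then show "y \<le> r *\<^sub>R v \<bullet> \<beta>"
      using support_function_ge[OF B(1), of \<gamma> v] \<beta> \<open>0 \<le> r\<close> by (simp add: mult_left_mono)
  qed (use B \<beta> in auto)
  then show ?thesis using \<beta> by (simp add: support_function_def)
qed

lemma continuous_on_support_function:
  assumes "finite B" "B \<noteq> {}"
  shows "continuous_on X (support_function B)"
  using assms
proof (induction B rule: finite_ne_induct)
  case (singleton \<beta>)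
  then show ?case by (auto simp: support_function_def[abs_def] intro!: continuous_intros)
next
  case (insert \<beta> B)
  have "support_function (insert \<beta> B) = (\<lambda>v. max (v \<bullet> \<beta>) (support_function B v))"
    using insert by (simp add: support_function_def fun_eq_iff)
  then show ?case using insert.IH by (auto intro!: continuous_intros)
qed

lemma exp_sum_le_support_function:
  assumes B: "finite B" and d: "\<And>\<beta>. \<beta> \<in> B \<Longrightarrow> 0 < d \<beta>"
  shows "exp_sum B d x \<le> sum d B * exp (support_function B x)"
  unfolding exp_sum_def sum_distrib_right
proof (intro sum_mono mult_left_mono)
  show "exp (\<beta> \<bullet> x) \<le> exp (support_function B x)" if "\<beta> \<in> B" for \<beta>
    using support_function_ge[OF B that, of x] by (simp add: inner_commute)
qed (use d in \<open>auto simp: less_imp_le\<close>)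

lemma exp_sum_ge_support_function:
  assumes B: "finite B" "B \<noteq> {}" and "0 < c" and d: "\<And>\<beta>. \<beta> \<in> B \<Longrightarrow> c \<le> d \<beta>"
  shows "c * exp (support_function B x) \<le> exp_sum B d x"
proof -
  obtain \<beta> where \<beta>: "\<beta> \<in> B" "support_function B x = x \<bullet> \<beta>"
    using support_function_attained[OF B] by blast
  have d0: "0 \<le> d \<gamma>" if "\<gamma> \<in> B" for \<gamma> using d[OF that] \<open>0 < c\<close> by linarith
  have "c * exp (support_function B x) \<le> d \<beta> * exp (\<beta> \<bullet> x)"
    using d[OF \<beta>(1)] by (simp add: \<beta>(2) inner_commute)
  also have "\<dots> \<le> exp_sum B d x"
    unfolding exp_sum_def using d0 \<beta> B by (intro member_le_sum) auto
  finally show ?thesis .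
qed

text \<open>
  Convexity of \<open>r \<mapsto> exp (r * t)\<close> between \<open>0\<close> and \<open>s\<close>, evaluated at \<open>1\<close>.
\<close>
lemma scaled_exp_ge:
  fixes s t :: real
  assumes "1 \<le> s"
  shows "s * exp t - (s - 1) \<le> exp (s * t)"
proof -
  have "exp t * (1 - t) \<le> exp t * exp (- t)"
    using exp_ge_add_one_self[of "- t"] by (intro mult_left_mono) auto
  then have "exp t - 1 \<le> t * exp t" by (simp add: exp_minus algebra_simps)
  then have "(s - 1) * (exp t - 1) \<le> (s - 1) * (t * exp t)" using assms by (intro mult_left_mono) auto
  moreover have "exp t * (1 + (s - 1) * t) \<le> exp t * exp ((s - 1) * t)"
    using exp_ge_add_one_self by (intro mult_left_mono) auto
  moreover have "exp t * exp ((s - 1) * t) = exp (s * t)" by (simp add: exp_add[symmetric] algebra_simps)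
  ultimately show ?thesis by (simp add: algebra_simps)
qed

context
  fixes P N :: "(real^'n) set" and d :: "real^'n \<Rightarrow> real" and T c :: real
    and E S :: "real^'n \<Rightarrow> real"
  defines "E \<equiv> \<lambda>x. exp_sum N d x - exp T * exp_sum P d x"
    and "S \<equiv> \<lambda>x. support_function N x - support_function P x"
  assumes fin: "finite P" "finite N" and ne: "P \<noteq> {}" "N \<noteq> {}"
    and d_pos: "\<And>\<beta>. \<beta> \<in> P \<union> N \<Longrightarrow> 0 < d \<beta>"
    and c: "0 < c" "\<And>\<alpha>. \<alpha> \<in> P \<Longrightarrow> c \<le> d \<alpha>"
    and T: "0 < T" "sum d N < exp (T / 2) * c"
begin

lemma support_difference_scaleR: "0 \<le> r \<Longrightarrow> S (r *\<^sub>R x) = r * S x"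
  using fin ne by (simp add: S_def support_function_scaleR right_diff_distrib)

text \<open>
  The zero set of \<open>E\<close> stays in \<open>{x. T / 2 < S x}\<close>, so it avoids all rays on which \<open>S\<close> is not positive.
\<close>
lemma support_difference_large_if_nonneg:
  assumes "0 \<le> E x"
  shows "T / 2 < S x"
proof -
  have "exp T * (c * exp (support_function P x)) \<le> exp T * exp_sum P d x"
    using c fin ne by (intro mult_left_mono exp_sum_ge_support_function) auto
  also have "\<dots> \<le> exp_sum N d x" using assms by (simp add: E_def)
  also have "\<dots> \<le> sum d N * exp (support_function N x)"
    using fin d_pos by (intro exp_sum_le_support_function) auto
  also have "\<dots> < exp (T / 2) * c * exp (support_function N x)" using T by simp
  finally have "c * exp (T + support_function P x) < c * exp (T / 2 + support_function N x)"
    by (simp add: exp_add mult_ac)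
  then show ?thesis using c(1) by (simp add: S_def)
qed

text \<open>
  Divide both sums by \<open>exp (r * support_function P x)\<close> along the ray \<open>r *\<^sub>R x\<close>. The positive part is then
  nonincreasing in \<open>r\<close>. The negative part is convex in \<open>r\<close> and, where \<open>E\<close> is nonnegative, exceeds its value
  at \<open>r = 0\<close> because \<open>T\<close> is large; hence it increases from there on.
\<close>
lemma positivity_persists_along_rays:
  assumes E: "0 \<le> E x" and s: "1 < s"
  shows "0 < E (s *\<^sub>R x)"
proof -
  define k where "k = support_function P x"
  define Q where "Q = (\<lambda>B r. \<Sum>\<beta>\<in>B. d \<beta> * exp (r * (\<beta> \<bullet> x - k)))"
  have exp_sum_Q: "exp_sum B d (r *\<^sub>R x) = exp (r * k) * Q B r" for B r
    by (simp add: exp_sum_def Q_def sum_distrib_left exp_diff right_diff_distrib mult_ac)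
  have E_Q: "E (r *\<^sub>R x) = exp (r * k) * (Q N r - exp T * Q P r)" for r
    by (simp add: E_def exp_sum_Q algebra_simps)
  have QP: "Q P s \<le> Q P 1"
    unfolding Q_def
  proof (intro sum_mono mult_left_mono)
    fix \<alpha> assume \<alpha>: "\<alpha> \<in> P"
    have "\<alpha> \<bullet> x - k \<le> 0" using support_function_ge[OF fin(1) \<alpha>, of x] by (simp add: k_def inner_commute)
    then have "(s - 1) * (\<alpha> \<bullet> x - k) \<le> 0" using s by (simp add: mult_le_0_iff)
    then show "exp (s * (\<alpha> \<bullet> x - k)) \<le> exp (1 * (\<alpha> \<bullet> x - k))" by (simp add: algebra_simps)
  qed (use d_pos in \<open>auto simp: less_imp_le\<close>)
  have start: "exp T * Q P 1 \<le> Q N 1" using E E_Q[of 1] by (simp add: zero_le_mult_iff)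
  have "sum d N < exp T * c"
  proof -
    have "exp (T / 2) * c \<le> exp T * c" using T c by simp
    then show ?thesis using T(2) by linarith
  qed
  also have "exp T * c \<le> exp T * Q P 1"
  proof -
    have "c * exp k \<le> exp k * Q P 1"
      using exp_sum_ge_support_function[OF fin(1) ne(1) c(1), of d x] c(2) exp_sum_Q[of P 1] by (simp add: k_def)
    then show ?thesis by simp
  qed
  finally have big: "sum d N < Q N 1" using start by linarith
  have "s * Q N 1 - (s - 1) * sum d N = (\<Sum>\<beta>\<in>N. d \<beta> * (s * exp (\<beta> \<bullet> x - k) - (s - 1)))"
    by (simp add: Q_def sum_distrib_left sum_subtractf sum.distrib algebra_simps)
  also have "\<dots> \<le> Q N s"
    unfolding Q_def using s d_pos by (intro sum_mono mult_left_mono scaled_exp_ge) (auto simp: less_imp_le)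
  finally have "s * Q N 1 - (s - 1) * sum d N \<le> Q N s" .
  moreover have "0 < (s - 1) * (Q N 1 - sum d N)" using s big by simp
  ultimately have "Q N 1 < Q N s" by (simp add: algebra_simps)
  moreover have "exp T * Q P s \<le> exp T * Q P 1" using QP by simp
  ultimately have "0 < Q N s - exp T * Q P s" using start by linarith
  then show ?thesis by (simp add: E_Q)
qed

lemma eventually_positive_along_rays:
  assumes "0 < S x"
  shows "\<exists>s>0. 0 < E (s *\<^sub>R x)"
proof -
  define e where "e = Min (d ` N)"
  have e: "0 < e" "\<And>\<beta>. \<beta> \<in> N \<Longrightarrow> e \<le> d \<beta>" using fin ne d_pos by (auto simp: e_def)
  define D where "D = sum d P"
  have D: "0 < D" unfolding D_def using fin ne d_pos by (intro sum_pos) auto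
  define s where "s = (T + \<bar>ln (D / e)\<bar> + 1) / S x"
  have s: "0 < s" using assms T by (simp add: s_def add_pos_nonneg)
  have "exp (T + ln (D / e)) < exp (S (s *\<^sub>R x))"
    using assms s support_difference_scaleR[of s x] by (simp add: s_def)
  then have "exp T * (D / e) < exp (S (s *\<^sub>R x))" using D e by (simp add: exp_add)
  then have "exp T * D < exp (S (s *\<^sub>R x)) * e" using e by (simp add: field_simps)
  then have "exp T * D * exp (support_function P (s *\<^sub>R x))
      < exp (S (s *\<^sub>R x)) * e * exp (support_function P (s *\<^sub>R x))" by simp
  also have "\<dots> = e * exp (support_function N (s *\<^sub>R x))" by (simp add: S_def exp_diff)
  also have "\<dots> \<le> exp_sum N d (s *\<^sub>R x)"
    using e fin ne by (intro exp_sum_ge_support_function) auto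
  finally have "exp T * (D * exp (support_function P (s *\<^sub>R x))) < exp_sum N d (s *\<^sub>R x)"
    by (simp add: mult_ac)
  moreover have "exp T * exp_sum P d (s *\<^sub>R x) \<le> exp T * (D * exp (support_function P (s *\<^sub>R x)))"
    unfolding D_def using fin d_pos by (intro mult_left_mono exp_sum_le_support_function) auto
  ultimately have "0 < E (s *\<^sub>R x)" unfolding E_def by linarith
  then show ?thesis using s by blast
qed

text \<open>
  On each ray with \<open>0 < S x\<close> the function \<open>E\<close> changes sign exactly once, and the other rays miss its
  zero set. So the zero set of \<open>E\<close> and the level set of \<open>S\<close> are radial graphs over the same directions.
\<close>
lemma zero_set_isotopic_to_support_level: "same_isotopy_type {x. S x = T} {x. E x = 0}"
proof -
  have E_cont: "continuous_on X E" for X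
    unfolding E_def by (intro continuous_intros continuous_on_exp_sum)
  have crossing: "\<exists>s>0. E (s *\<^sub>R x) = 0" if Sx: "0 < S x" for x
  proof -
    obtain s where s: "0 < s" "0 < E (s *\<^sub>R x)" using eventually_positive_along_rays[OF Sx] by blast
    have "E (0 *\<^sub>R x) \<le> 0"
    proof (rule ccontr)
      assume "\<not> ?thesis"
      then have "T / 2 < S (0 *\<^sub>R x)" by (intro support_difference_large_if_nonneg) simp
      then show False using support_difference_scaleR[of 0 x] T by simp
    qed
    then have "\<exists>r\<ge>0. r \<le> s \<and> E (r *\<^sub>R x) = 0"
      using s by (intro IVT'[where f = "\<lambda>r. E (r *\<^sub>R x)"] continuous_on_compose2[OF E_cont[of UNIV]] continuous_intros) auto
    then obtain r where r: "0 \<le> r" "E (r *\<^sub>R x) = 0" by blast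
    have "T / 2 < S (r *\<^sub>R x)" using r by (intro support_difference_large_if_nonneg) simp
    then have "r \<noteq> 0" using support_difference_scaleR[of 0 x] T by auto
    then show ?thesis using r by (intro exI[of _ r]) simp
  qed
  define \<sigma> where "\<sigma> = (\<lambda>x. SOME s. 0 < s \<and> E (s *\<^sub>R x) = 0)"
  have \<sigma>: "0 < \<sigma> x" "E (\<sigma> x *\<^sub>R x) = 0" if "0 < S x" for x
    using someI_ex[OF crossing[OF that]] by (auto simp: \<sigma>_def)
  have below: "E (s *\<^sub>R x) < 0" if "0 < S x" "0 < s" "s < \<sigma> x" for s x
  proof (rule ccontr)
    assume "\<not> ?thesis"
    then have "0 < E ((\<sigma> x / s) *\<^sub>R (s *\<^sub>R x))" using that by (intro positivity_persists_along_rays) auto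
    then show False using \<sigma>[OF that(1)] that by simp
  qed
  have above: "0 < E (s *\<^sub>R x)" if "0 < S x" "\<sigma> x < s" for s x
  proof -
    have "0 < E ((s / \<sigma> x) *\<^sub>R (\<sigma> x *\<^sub>R x))"
      using that \<sigma>[OF that(1)] by (intro positivity_persists_along_rays) auto
    then show ?thesis using \<sigma>[OF that(1)] by simp
  qed
  have \<sigma>_unique: "s = \<sigma> x" if "0 < S x" "0 < s" "E (s *\<^sub>R x) = 0" for s x
    using below[OF that(1,2)] above[OF that(1), of s] that(3) by (cases s "\<sigma> x" rule: linorder_cases) auto
  have \<sigma>_cont: "continuous_on {x. 0 < S x} \<sigma>"
    unfolding continuous_on_def
  proof (intro ballI order_tendstoI)
    fix x a assume x: "x \<in> {x. 0 < S x}"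
    let ?F = "at x within {x. 0 < S x}"
    have inside: "\<forall>\<^sub>F y in ?F. 0 < S y" by (simp add: eventually_at_filter)
    have E_lim: "((\<lambda>y. E (r *\<^sub>R y)) \<longlongrightarrow> E (r *\<^sub>R x)) ?F" for r
    proof -
      have "continuous_on UNIV (\<lambda>y. E (r *\<^sub>R y))"
        by (intro continuous_on_compose2[OF E_cont[of UNIV]] continuous_intros) auto
      then have "((\<lambda>y. E (r *\<^sub>R y)) \<longlongrightarrow> E (r *\<^sub>R x)) (at x)" by (simp add: continuous_on_def)
      then show ?thesis by (rule tendsto_within_subset) simp
    qed
    {
      assume a: "a < \<sigma> x"
      show "\<forall>\<^sub>F y in ?F. a < \<sigma> y"
      proof (cases "0 < a")
        case True
        then have "E (a *\<^sub>R x) < 0" using below a x by simp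
        with E_lim have "\<forall>\<^sub>F y in ?F. E (a *\<^sub>R y) < 0" by (rule order_tendstoD)
        with inside show ?thesis
        proof eventually_elim
          case (elim y)
          then show ?case using above[of y a] \<sigma>[of y] by (cases a "\<sigma> y" rule: linorder_cases) auto
        qed
      next
        case False
        from inside show ?thesis by eventually_elim (use False \<sigma> in force)
      qed
    }
    {
      assume a: "\<sigma> x < a"
      then have "0 < E (a *\<^sub>R x)" using above x by simp
      with E_lim have "\<forall>\<^sub>F y in ?F. 0 < E (a *\<^sub>R y)" by (rule order_tendstoD)
      with inside show "\<forall>\<^sub>F y in ?F. \<sigma> y < a"
      proof eventually_elim
        case (elim y)
        have "0 < a" using a \<sigma>[of x] x by auto
        then show ?case using elim below[of y a] \<sigma>[of y] by (cases a "\<sigma> y" rule: linorder_cases) auto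
      qed
    }
  qed
  \<comment> \<open>On the ray of \<open>x\<close> the crossing point has \<open>S\<close>-value \<open>\<sigma> x * S x\<close>, a quantity of degree \<open>0\<close>.\<close>
  define \<rho> where "\<rho> = (\<lambda>x. \<sigma> x * S x / T)"
  have S_cont: "continuous_on X S" for X
    unfolding S_def using fin ne by (intro continuous_intros continuous_on_support_function)
  have "same_isotopy_type {x. S x = T} {x. 0 < S x \<and> S x = T * \<rho> x}"
  proof (rule star_shaped_isotopic[OF S_cont _ T(1)])
    show "S (r *\<^sub>R x) = r * S x" if "0 < r" for r x using that by (simp add: support_difference_scaleR)
    show "continuous_on {x. 0 < S x} \<rho>"
      unfolding \<rho>_def using T by (intro continuous_intros \<sigma>_cont S_cont) auto
    show "\<rho> (r *\<^sub>R x) = \<rho> x" if r: "0 < r" and x: "0 < S x" for r x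
    proof -
      have "\<sigma> x / r = \<sigma> (r *\<^sub>R x)"
        using r x \<sigma>[OF x] support_difference_scaleR[of r x] by (intro \<sigma>_unique) auto
      then have "\<sigma> (r *\<^sub>R x) = \<sigma> x / r" by simp
      then show ?thesis using r support_difference_scaleR[of r x] by (simp add: \<rho>_def)
    qed
    show "1 / 2 < \<rho> x" if x: "0 < S x" for x
    proof -
      have "T / 2 < S (\<sigma> x *\<^sub>R x)" using \<sigma>[OF x] by (intro support_difference_large_if_nonneg) simp
      then have "T / 2 < \<sigma> x * S x" using support_difference_scaleR[of "\<sigma> x" x] \<sigma>[OF x] by simp
      then show ?thesis using T by (simp add: \<rho>_def field_simps)
    qed
  qed
  moreover have "{x. 0 < S x \<and> S x = T * \<rho> x} = {x. E x = 0}"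
  proof (intro Collect_cong iffI conjI)
    fix x
    {
      assume "0 < S x \<and> S x = T * \<rho> x"
      then have "0 < S x" "\<sigma> x = 1" using T by (auto simp: \<rho>_def)
      then show "E x = 0" using \<sigma>(2)[of x] by simp
    }
    assume E: "E x = 0"
    then show S: "0 < S x" using support_difference_large_if_nonneg[of x] T by simp
    have "1 = \<sigma> x" using E S by (intro \<sigma>_unique) auto
    then show "S x = T * \<rho> x" using T by (simp add: \<rho>_def)
  qed
  ultimately show ?thesis by simp
qed

end

lemma high_level_isotopic_to_support_level:
  fixes P N :: "(real^'n) set"
  assumes fin: "finite P" "finite N" and ne: "P \<noteq> {}" "N \<noteq> {}"
    and d_pos: "\<And>\<beta>. \<beta> \<in> P \<union> N \<Longrightarrow> 0 < d \<beta>"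
  shows "\<exists>T>0. same_isotopy_type {x. support_function N x - support_function P x = T} {x. log_ratio P N d x = T}"
proof -
  define c where "c = Min (d ` P)"
  have c: "0 < c" "\<And>\<alpha>. \<alpha> \<in> P \<Longrightarrow> c \<le> d \<alpha>" using fin ne d_pos by (auto simp: c_def)
  define D where "D = sum d N"
  have D: "0 < D" unfolding D_def using fin ne d_pos by (intro sum_pos) auto
  \<comment> \<open>Large enough for \<open>D < exp (T / 2) * c\<close>.\<close>
  define T where "T = 2 * \<bar>ln (D / c)\<bar> + 1"
  have T: "0 < T" by (simp add: T_def)
  have "D / c = exp (ln (D / c))" using c D by simp
  also have "\<dots> < exp (T / 2)" unfolding exp_less_cancel_iff by (simp add: T_def)
  finally have "sum d N < exp (T / 2) * c" using c D by (simp add: field_simps D_def)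
  from zero_set_isotopic_to_support_level[OF fin ne d_pos c T this]
  have "same_isotopy_type {x. support_function N x - support_function P x = T}
      {x. exp_sum N d x - exp T * exp_sum P d x = 0}" by simp
  moreover have "exp_sum N d x - exp T * exp_sum P d x = 0 \<longleftrightarrow> log_ratio P N d x = T" for x
  proof -
    have pos: "0 < exp_sum P d x" "0 < exp_sum N d x" using fin ne d_pos by (auto intro!: exp_sum_pos)
    have "log_ratio P N d x = T \<longleftrightarrow> exp (log_ratio P N d x) = exp T" by simp
    also have "exp (log_ratio P N d x) = exp_sum N d x / exp_sum P d x"
      using pos by (simp add: log_ratio_def exp_diff)
    finally show ?thesis using pos by (auto simp: field_simps)
  qed
  ultimately show ?thesis using T by auto
qed

section \<open>Signed tropical hypersurfaces\<close>

text \<open>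
  At a critical point the normalized weights of \<open>P\<close> and of \<open>N\<close> have the same barycenter. Domination
  compares the factors by which the two sums change when passing from \<open>x\<close> to \<open>p\<close>.
\<close>
lemma critical_point_minimizes_log_ratio:
  fixes P N :: "(real^'n) set"
  assumes dom: "exp_dominated P N" and fin: "finite P" "finite N" and ne: "P \<noteq> {}" "N \<noteq> {}"
    and disj: "P \<inter> N = {}" and d_pos: "\<And>\<beta>. \<beta> \<in> P \<union> N \<Longrightarrow> 0 < d \<beta>"
    and crit: "log_ratio_grad P N d x = 0"
  shows "log_ratio P N d x \<le> log_ratio P N d p"
proof -
  have posP: "0 < exp_sum P d z" and posN: "0 < exp_sum N d z" for z
    using fin ne d_pos by (auto intro!: exp_sum_pos)
  \<comment> \<open>Normalizing each side separately makes both families probability weights.\<close>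
  define k where "k = (\<lambda>\<beta>. d \<beta> * exp (\<beta> \<bullet> x) / (if \<beta> \<in> P then exp_sum P d x else exp_sum N d x))"
  have kP: "k \<beta> = d \<beta> * exp (\<beta> \<bullet> x) / exp_sum P d x" if "\<beta> \<in> P" for \<beta> using that by (simp add: k_def)
  have kN: "k \<beta> = d \<beta> * exp (\<beta> \<bullet> x) / exp_sum N d x" if "\<beta> \<in> N" for \<beta> using that disj by (auto simp: k_def)
  have "exp_sum P k (p - x) \<le> exp_sum N k (p - x)"
  proof (rule dom[unfolded exp_dominated_def, rule_format])
    show "0 \<le> k \<alpha>" if "\<alpha> \<in> P" for \<alpha> using that d_pos[of \<alpha>] posP[of x] by (simp add: kP)
    show "0 \<le> k \<beta>" if "\<beta> \<in> N" for \<beta> using that d_pos[of \<beta>] posN[of x] by (simp add: kN)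
    show "sum k P = 1" using posP[of x] by (simp add: kP sum_divide_distrib[symmetric] exp_sum_def)
    show "sum k N = 1" using posN[of x] by (simp add: kN sum_divide_distrib[symmetric] exp_sum_def)
    have "weighted_mean P d x = (\<Sum>\<alpha>\<in>P. k \<alpha> *\<^sub>R \<alpha>)"
      by (simp add: weighted_mean_def scaleR_sum_right kP divide_inverse mult.commute)
    moreover have "weighted_mean N d x = (\<Sum>\<beta>\<in>N. k \<beta> *\<^sub>R \<beta>)"
      by (simp add: weighted_mean_def scaleR_sum_right kN divide_inverse mult.commute)
    ultimately show "(\<Sum>\<alpha>\<in>P. k \<alpha> *\<^sub>R \<alpha>) = (\<Sum>\<beta>\<in>N. k \<beta> *\<^sub>R \<beta>)"
      using crit by (simp add: log_ratio_grad_def)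
  qed
  moreover have "exp_sum P k (p - x) = exp_sum P d p / exp_sum P d x"
    unfolding exp_sum_def[of P k] exp_sum_def[of P d p] sum_divide_distrib
    by (intro sum.cong) (simp_all add: kP inner_diff_right exp_diff)
  moreover have "exp_sum N k (p - x) = exp_sum N d p / exp_sum N d x"
    unfolding exp_sum_def[of N k] exp_sum_def[of N d p] sum_divide_distrib
    by (intro sum.cong) (simp_all add: kN inner_diff_right exp_diff)
  ultimately have "ln (exp_sum P d p / exp_sum P d x) \<le> ln (exp_sum N d p / exp_sum N d x)"
    using posP posN by simp
  then show ?thesis using posP[of x] posN[of x] posP[of p] posN[of p] by (simp add: log_ratio_def ln_div)
qed

text \<open>
  For heights that depend on the sign only, the tropical hypersurface is a level set of a difference
  of support functions.
\<close>
lemma signed_trop_two_heights: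
  fixes A :: "(real^'n) set" and \<epsilon> :: "real^'n \<Rightarrow> real"
  defines "P \<equiv> pos_part A \<epsilon>" and "N \<equiv> neg_part A \<epsilon>"
  assumes A: "signed_support A \<epsilon>" and ne: "P \<noteq> {}" "N \<noteq> {}"
  shows "signed_trop A \<epsilon> (\<lambda>\<alpha>. if \<epsilon> \<alpha> = 1 then s else t)
    = {v. support_function P v + s = support_function N v + t}"
proof -
  let ?h = "\<lambda>\<alpha>. if \<epsilon> \<alpha> = 1 then s else t"
  have fin: "finite A" "finite P" "finite N" using A by (auto simp: signed_support_def P_def N_def pos_part_def neg_part_def)
  have h: "\<And>\<alpha>. \<alpha> \<in> P \<Longrightarrow> ?h \<alpha> = s" "\<And>\<alpha>. \<alpha> \<in> N \<Longrightarrow> ?h \<alpha> = t"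
    by (auto simp: P_def N_def pos_part_def neg_part_def)
  have PN: "\<beta> \<in> A \<longleftrightarrow> \<beta> \<in> P \<or> \<beta> \<in> N" for \<beta>
    using A by (auto simp: signed_support_def P_def N_def pos_part_def neg_part_def)
  have max_eq: "(MAX \<beta>\<in>A. v \<bullet> \<beta> + ?h \<beta>) = max (support_function P v + s) (support_function N v + t)" for v
  proof (rule Max_eqI)
    show "finite ((\<lambda>\<beta>. v \<bullet> \<beta> + ?h \<beta>) ` A)" using fin by simp
    show "y \<le> max (support_function P v + s) (support_function N v + t)"
      if y: "y \<in> (\<lambda>\<beta>. v \<bullet> \<beta> + ?h \<beta>) ` A" for y
    proof -
      obtain \<beta> where \<beta>: "\<beta> \<in> A" "y = v \<bullet> \<beta> + ?h \<beta>" using y by blast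
      then consider "\<beta> \<in> P" | "\<beta> \<in> N" using PN by blast
      then show ?thesis
      proof cases
        case 1
        then show ?thesis using support_function_ge[OF fin(2) 1, of v] h(1)[OF 1] \<beta>(2) by simp
      next
        case 2
        then show ?thesis using support_function_ge[OF fin(3) 2, of v] h(2)[OF 2] \<beta>(2) by simp
      qed
    qed
    obtain \<alpha> where \<alpha>: "\<alpha> \<in> P" "support_function P v = v \<bullet> \<alpha>"
      using support_function_attained[OF fin(2) ne(1)] by blast
    obtain \<beta> where \<beta>: "\<beta> \<in> N" "support_function N v = v \<bullet> \<beta>"
      using support_function_attained[OF fin(3) ne(2)] by blast
    have "support_function P v + s \<in> (\<lambda>\<beta>. v \<bullet> \<beta> + ?h \<beta>) ` A"
      using \<alpha> PN h(1)[OF \<alpha>(1)] by (intro image_eqI[of _ _ \<alpha>]) simp_all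
    moreover have "support_function N v + t \<in> (\<lambda>\<beta>. v \<bullet> \<beta> + ?h \<beta>) ` A"
      using \<beta> PN h(2)[OF \<beta>(1)] by (intro image_eqI[of _ _ \<beta>]) simp_all
    ultimately show "max (support_function P v + s) (support_function N v + t) \<in> (\<lambda>\<beta>. v \<bullet> \<beta> + ?h \<beta>) ` A"
      unfolding max_def by presburger
  qed
  have attained: "(\<exists>\<beta>\<in>B. v \<bullet> \<beta> + ?h \<beta> = max (support_function P v + s) (support_function N v + t))
      \<longleftrightarrow> support_function B v + u = max (support_function P v + s) (support_function N v + t)"
    if B: "finite B" "B \<noteq> {}" "\<And>\<beta>. \<beta> \<in> B \<Longrightarrow> ?h \<beta> = u"
      and le: "support_function B v + u \<le> max (support_function P v + s) (support_function N v + t)" for B u v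
  proof
    assume "\<exists>\<beta>\<in>B. v \<bullet> \<beta> + ?h \<beta> = max (support_function P v + s) (support_function N v + t)"
    then obtain \<beta> where \<beta>: "\<beta> \<in> B" "v \<bullet> \<beta> + ?h \<beta> = max (support_function P v + s) (support_function N v + t)"
      by blast
    have "v \<bullet> \<beta> + u = max (support_function P v + s) (support_function N v + t)"
      using \<beta>(2) unfolding B(3)[OF \<beta>(1)] .
    then show "support_function B v + u = max (support_function P v + s) (support_function N v + t)"
      using support_function_ge[OF B(1) \<beta>(1), of v] le by linarith
  next
    assume eq: "support_function B v + u = max (support_function P v + s) (support_function N v + t)"
    obtain \<beta> where \<beta>: "\<beta> \<in> B" "support_function B v = v \<bullet> \<beta>"
      using support_function_attained[OF B(1,2)] by blast
    then show "\<exists>\<beta>\<in>B. v \<bullet> \<beta> + ?h \<beta> = max (support_function P v + s) (support_function N v + t)"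
      using eq B(3)[OF \<beta>(1)] by (intro bexI[of _ \<beta>]) simp_all
  qed
  have "v \<in> signed_trop A \<epsilon> ?h \<longleftrightarrow> support_function P v + s = support_function N v + t" for v
  proof -
    have "v \<in> signed_trop A \<epsilon> ?h \<longleftrightarrow>
        support_function P v + s = max (support_function P v + s) (support_function N v + t) \<and>
        support_function N v + t = max (support_function P v + s) (support_function N v + t)"
      using attained[OF fin(2) ne(1) h(1), of v] attained[OF fin(3) ne(2) h(2), of v]
      unfolding signed_trop_def mem_Collect_eq max_eq P_def[symmetric] N_def[symmetric] by simp
    then show ?thesis by (auto simp: max_def)
  qed
  then show ?thesis by blast
qed

text \<open>
  A zero would be a local maximum, hence a singular zero.
\<close>
lemma nonpositive_exp_sum_has_no_zero:
  fixes A :: "(real^'n) set"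
  assumes smooth: "smooth_zero_set (exp_sum A c)" and nonpos: "\<And>x. exp_sum A c x \<le> 0"
  shows "exp_sum A c x < 0"
proof (rule ccontr)
  assume "\<not> ?thesis"
  then have zero: "exp_sum A c x = 0" using nonpos[of x] by simp
  have "((\<lambda>t. exp_sum A c (x + t *\<^sub>R axis i 1)) has_real_derivative 0) (at 0)" for i
  proof -
    let ?u = "axis i 1 :: real^'n"
    have "((\<lambda>t. x + t *\<^sub>R ?u) has_derivative (\<lambda>h. h *\<^sub>R ?u)) (at 0)"
      by (auto intro!: derivative_eq_intros)
    from has_derivative_compose[OF this, of "exp_sum A c" "\<lambda>h. \<Sum>\<beta>\<in>A. c \<beta> * exp (\<beta> \<bullet> x) * (\<beta> \<bullet> h)"]
    have "((\<lambda>t. exp_sum A c (x + t *\<^sub>R ?u)) has_derivative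
        (\<lambda>h. \<Sum>\<beta>\<in>A. c \<beta> * exp (\<beta> \<bullet> x) * (\<beta> \<bullet> h *\<^sub>R ?u))) (at 0)"
      using exp_sum_has_derivative[of A c x] by simp
    moreover have "(\<lambda>h. \<Sum>\<beta>\<in>A. c \<beta> * exp (\<beta> \<bullet> x) * (\<beta> \<bullet> h *\<^sub>R ?u))
        = (*) (\<Sum>\<beta>\<in>A. c \<beta> * exp (\<beta> \<bullet> x) * (\<beta> \<bullet> ?u))"
      by (simp add: fun_eq_iff sum_distrib_left mult_ac)
    ultimately have D: "((\<lambda>t. exp_sum A c (x + t *\<^sub>R ?u)) has_real_derivative
        (\<Sum>\<beta>\<in>A. c \<beta> * exp (\<beta> \<bullet> x) * (\<beta> \<bullet> ?u))) (at 0)"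
      by (simp only: has_field_derivative_def)
    have "(\<Sum>\<beta>\<in>A. c \<beta> * exp (\<beta> \<bullet> x) * (\<beta> \<bullet> ?u)) = 0"
      by (rule DERIV_local_max[OF D zero_less_one]) (use nonpos zero in simp)
    then show ?thesis using D by simp
  qed
  then show False using smooth zero by (auto simp: smooth_zero_set_def)
qed

text \<open>
  Far out on a ray, each sum grows like the exponential of its support function.
\<close>
lemma support_function_le_if_exp_sum_less:
  fixes P N :: "(real^'n) set"
  assumes fin: "finite P" "finite N" and ne: "P \<noteq> {}" "N \<noteq> {}"
    and d_pos: "\<And>\<beta>. \<beta> \<in> P \<union> N \<Longrightarrow> 0 < d \<beta>"
    and less: "\<And>x. exp_sum P d x < exp_sum N d x"
  shows "support_function P v \<le> support_function N v"
proof (rule ccontr)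
  assume gap: "\<not> ?thesis"
  define q where "q = support_function P v - support_function N v"
  have q: "0 < q" using gap by (simp add: q_def)
  define c where "c = Min (d ` P)"
  have c: "0 < c" "\<And>\<alpha>. \<alpha> \<in> P \<Longrightarrow> c \<le> d \<alpha>" using fin ne d_pos by (auto simp: c_def)
  define D where "D = sum d N"
  have D: "0 < D" unfolding D_def using fin ne d_pos by (intro sum_pos) auto
  \<comment> \<open>At \<open>r *\<^sub>R v\<close> the gap \<open>r * q\<close> between the support functions outweighs the ratio of the coefficients.\<close>
  define r where "r = \<bar>ln (D / c)\<bar> / q"
  have r: "0 \<le> r" using q by (simp add: r_def)
  have "D / c = exp (ln (D / c))" using c D by simp
  also have "\<dots> \<le> exp (r * q)" unfolding exp_le_cancel_iff using q by (simp add: r_def)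
  finally have "D \<le> c * exp (r * q)" using c by (simp add: field_simps)
  then have "D * exp (r * support_function N v) \<le> c * exp (r * q) * exp (r * support_function N v)" by simp
  also have "\<dots> = c * exp (r * support_function P v)"
    by (simp add: q_def mult.assoc exp_add[symmetric] algebra_simps)
  also have "\<dots> \<le> exp_sum P d (r *\<^sub>R v)"
    using exp_sum_ge_support_function[OF fin(1) ne(1) c(1), of d "r *\<^sub>R v"] c(2) fin ne r
    by (simp add: support_function_scaleR)
  also have "\<dots> < exp_sum N d (r *\<^sub>R v)" by (rule less)
  also have "\<dots> \<le> D * exp (r * support_function N v)"
    using exp_sum_le_support_function[OF fin(2), of d "r *\<^sub>R v"] d_pos fin ne r
    by (simp add: support_function_scaleR D_def)
  finally show False by simp
qed

text \<open>
  Levels between \<open>0\<close> and a large \<open>T\<close> are joined through regular values: a critical point is a global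
  minimum, and the minimum lies below \<open>log_ratio P N d p < 0\<close>.
\<close>
lemma zero_level_isotopic_to_support_level:
  fixes P N :: "(real^'n) set"
  assumes fin: "finite P" "finite N" and ne: "P \<noteq> {}" "N \<noteq> {}" and disj: "P \<inter> N = {}"
    and d_pos: "\<And>\<beta>. \<beta> \<in> P \<union> N \<Longrightarrow> 0 < d \<beta>"
    and full: "affine hull (P \<union> N) = UNIV" and dom: "exp_dominated P N"
    and faces: "\<And>F. F face_of convex hull (P \<union> N) \<Longrightarrow> F \<noteq> {} \<Longrightarrow> F \<noteq> convex hull (P \<union> N) \<Longrightarrow>
      \<exists>v c. (\<forall>\<alpha>\<in>P \<inter> F. c \<le> \<alpha> \<bullet> v) \<and> (\<forall>\<beta>\<in>N \<inter> F. \<beta> \<bullet> v \<le> c) \<and> (\<exists>\<mu>\<in>(P \<union> N) \<inter> F. \<mu> \<bullet> v \<noteq> c)"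
    and p: "log_ratio P N d p < 0"
  shows "\<exists>T>0. same_isotopy_type {x. support_function N x - support_function P x = T} {x. log_ratio P N d x = 0}"
proof -
  let ?\<Psi> = "log_ratio P N d" and ?g = "log_ratio_grad P N d"
  obtain T where T: "0 < T"
    and iso: "same_isotopy_type {x. support_function N x - support_function P x = T} {x. ?\<Psi> x = T}"
    using high_level_isotopic_to_support_level[where d = d, OF fin ne d_pos] by blast
  \<comment> \<open>The band must contain \<open>0\<close> and \<open>T\<close> in its interior and stay above the value at \<open>p\<close>.\<close>
  define a b where "a = ?\<Psi> p / 2" and "b = T + 1"
  have "?g x \<noteq> 0" if "a \<le> ?\<Psi> x" for x
  proof
    assume "?g x = 0"
    then have "?\<Psi> x \<le> ?\<Psi> p" using dom fin ne disj d_pos by (intro critical_point_minimizes_log_ratio)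
    then show False using that p by (simp add: a_def)
  qed
  then obtain \<delta> where \<delta>: "0 < \<delta>" "\<And>x. a \<le> ?\<Psi> x \<Longrightarrow> ?\<Psi> x \<le> b \<Longrightarrow> \<delta> \<le> norm (?g x)"
    using log_ratio_grad_bounded_below[where d = d and a = a and b = b, OF fin ne disj d_pos full faces] by blast
  define R where "R = Max (norm ` (P \<union> N))"
  have R: "norm \<beta> \<le> R" if "\<beta> \<in> P \<union> N" for \<beta> using that fin by (simp add: R_def)
  have bound: "norm (?g x) \<le> R + R" for x
    unfolding log_ratio_grad_def using fin ne d_pos R
    by (intro order_trans[OF norm_triangle_ineq4] add_mono norm_weighted_mean_le) auto
  have lip: "norm (?g x - ?g y) \<le> (4 * R\<^sup>2 + 1) * norm (x - y)" for x y
  proof -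
    have "?g x - ?g y = (weighted_mean N d x - weighted_mean N d y) - (weighted_mean P d x - weighted_mean P d y)"
      by (simp add: log_ratio_grad_def)
    also have "norm \<dots> \<le> 2 * R\<^sup>2 * norm (x - y) + 2 * R\<^sup>2 * norm (x - y)"
      using fin ne d_pos R
      by (intro order_trans[OF norm_triangle_ineq4] add_mono weighted_mean_lipschitz) auto
    also have "\<dots> \<le> (4 * R\<^sup>2 + 1) * norm (x - y)" by (simp add: algebra_simps)
    finally show ?thesis .
  qed
  have "same_isotopy_type {x. ?\<Psi> x = T} {x. ?\<Psi> x = 0}"
  proof (rule levels_isotopic[where a = a and b = b, OF _ bound lip _ \<delta>])
    show "(?\<Psi> has_derivative (\<lambda>h. ?g x \<bullet> h)) (at x)" for x
      using fin ne d_pos by (intro log_ratio_has_derivative)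
    show "0 < 4 * R\<^sup>2 + 1" by (simp add: add_nonneg_pos)
  qed (use p T in \<open>auto simp: a_def b_def\<close>)
  then show ?thesis using same_isotopy_type_trans[OF iso] T by blast
qed

text \<open>
  If the exponential sum takes a positive value, raising the positive exponents to a large common
  height gives the isotopy type. If it is negative everywhere, raising the negative exponents gives an
  empty tropical hypersurface.
\<close>
lemma signed_trop_realizes_isotopy_type:
  fixes A :: "(real^'n) set"
  assumes A: "signed_support A \<epsilon>" and full: "full_dimensional A"
    and dom: "exp_dominated (pos_part A \<epsilon>) (neg_part A \<epsilon>)"
    and faces: "\<And>F. F face_of (convex hull A) \<Longrightarrow> F \<noteq> {} \<Longrightarrow> F \<noteq> convex hull A \<Longrightarrow>
           \<exists>v a. nontrivial_separating_hyperplane (A \<inter> F) \<epsilon> v a"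
    and c: "c \<in> coeffs_with_signs A \<epsilon>" and smooth: "smooth_zero_set (exp_sum A c)"
  shows "\<exists>h. same_isotopy_type (signed_trop A \<epsilon> h) (zero_set (exp_sum A c))"
proof -
  define P N where "P = pos_part A \<epsilon>" and "N = neg_part A \<epsilon>"
  define d where "d = (\<lambda>\<alpha>. \<bar>c \<alpha>\<bar>)"
  have PN: "A = P \<union> N" "P \<inter> N = {}" and fin: "finite P" "finite N"
    using A by (auto simp: signed_support_def P_def N_def pos_part_def neg_part_def)
  have cP: "0 < c \<alpha>" if "\<alpha> \<in> P" for \<alpha>
    using that c by (auto simp: coeffs_with_signs_def P_def pos_part_def sgn_1_pos)
  have cN: "c \<alpha> < 0" if "\<alpha> \<in> N" for \<alpha>
    using that c by (auto simp: coeffs_with_signs_def N_def neg_part_def sgn_1_neg)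
  have d_pos: "0 < d \<beta>" if "\<beta> \<in> P \<union> N" for \<beta> using that cP[of \<beta>] cN[of \<beta>] by (auto simp: d_def)
  have split: "exp_sum A c x = exp_sum P d x - exp_sum N d x" for x
  proof -
    have "exp_sum A c x = (\<Sum>\<alpha>\<in>P. c \<alpha> * exp (\<alpha> \<bullet> x)) + (\<Sum>\<alpha>\<in>N. c \<alpha> * exp (\<alpha> \<bullet> x))"
      unfolding exp_sum_def PN(1) using fin PN(2) by (intro sum.union_disjoint)
    also have "(\<Sum>\<alpha>\<in>P. c \<alpha> * exp (\<alpha> \<bullet> x)) = exp_sum P d x"
      unfolding exp_sum_def d_def using cP by (intro sum.cong) (auto simp: abs_of_pos)
    also have "(\<Sum>\<alpha>\<in>N. c \<alpha> * exp (\<alpha> \<bullet> x)) = - exp_sum N d x"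
      unfolding exp_sum_def d_def sum_negf[symmetric] using cN by (intro sum.cong) (auto simp: abs_of_neg)
    finally show ?thesis by simp
  qed
  have full': "affine hull A = UNIV"
    using full by (simp add: full_dimensional_def aff_dim_convex_hull flip: aff_dim_eq_full)
  have pos: "0 < exp_sum B d x" if "B = P \<or> B = N" "B \<noteq> {}" for B x
    using that fin d_pos by (intro exp_sum_pos) auto
  show ?thesis
  proof (cases "P = {} \<or> N = {}")
    case True
    have "P \<noteq> {} \<or> N \<noteq> {}" using full' PN by auto
    moreover have "exp_sum {} d x = 0" for x by (simp add: exp_sum_def)
    ultimately have "exp_sum A c x \<noteq> 0" for x
      using True pos[of P x] pos[of N x] unfolding split by fastforce
    then have "zero_set (exp_sum A c) = {}" by (simp add: zero_set_def)
    moreover have "signed_trop A \<epsilon> h = {}" for h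
      using True by (auto simp: signed_trop_def P_def N_def)
    ultimately show ?thesis by (simp add: same_isotopy_type_refl)
  next
    case False
    then have ne: "P \<noteq> {}" "N \<noteq> {}" by auto
    have trop: "signed_trop A \<epsilon> (\<lambda>\<alpha>. if \<epsilon> \<alpha> = 1 then s else t)
        = {v. support_function P v + s = support_function N v + t}" for s t
      using signed_trop_two_heights[OF A] ne by (simp add: P_def N_def)
    show ?thesis
    proof (cases "\<exists>p. 0 < exp_sum A c p")
      case True
      then obtain p where "0 < exp_sum A c p" by blast
      then have p: "log_ratio P N d p < 0"
        using pos[of P p] pos[of N p] ne by (simp add: split log_ratio_def)
      have faces': "\<exists>v b. (\<forall>\<alpha>\<in>P \<inter> F. b \<le> \<alpha> \<bullet> v) \<and> (\<forall>\<beta>\<in>N \<inter> F. \<beta> \<bullet> v \<le> b) \<and> (\<exists>\<mu>\<in>(P \<union> N) \<inter> F. \<mu> \<bullet> v \<noteq> b)"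
        if F: "F face_of convex hull (P \<union> N)" "F \<noteq> {}" "F \<noteq> convex hull (P \<union> N)" for F
      proof -
        obtain v b where vb: "nontrivial_separating_hyperplane (A \<inter> F) \<epsilon> v b"
          using faces F unfolding PN(1)[symmetric] by blast
        then have v: "v \<noteq> 0" "pos_part (A \<inter> F) \<epsilon> \<subseteq> halfspace_ge v b" "neg_part (A \<inter> F) \<epsilon> \<subseteq> halfspace_le v b"
          by (auto simp: nontrivial_separating_hyperplane_def separating_hyperplane_def)
        have "P \<inter> F = pos_part (A \<inter> F) \<epsilon>" "N \<inter> F = neg_part (A \<inter> F) \<epsilon>"
          by (auto simp: P_def N_def pos_part_def neg_part_def)
        then have "\<forall>\<alpha>\<in>P \<inter> F. b \<le> \<alpha> \<bullet> v" "\<forall>\<beta>\<in>N \<inter> F. \<beta> \<bullet> v \<le> b"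
          using v(2,3) by (auto simp: halfspace_ge_def halfspace_le_def inner_commute)
        moreover have "\<exists>\<mu>\<in>(P \<union> N) \<inter> F. \<mu> \<bullet> v \<noteq> b"
        proof -
          have "interior (halfspace_ge v b) = {\<mu>. b < v \<bullet> \<mu>}" "interior (halfspace_le v b) = {\<mu>. v \<bullet> \<mu> < b}"
            using v(1) by (simp_all add: halfspace_ge_def halfspace_le_def)
          then show ?thesis
            using vb unfolding nontrivial_separating_hyperplane_def PN(1)[symmetric]
            by (auto simp: inner_commute)
        qed
        ultimately show ?thesis by blast
      qed
      have full_PN: "affine hull (P \<union> N) = UNIV" using full' PN(1) by simp
      have dom_PN: "exp_dominated P N" using dom by (simp add: P_def N_def)
      obtain T where iso: "same_isotopy_type {x. support_function N x - support_function P x = T} {x. log_ratio P N d x = 0}"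
        using zero_level_isotopic_to_support_level[where d = d, OF fin ne PN(2) d_pos full_PN dom_PN faces' p] by blast
      moreover have "{x. support_function N x - support_function P x = T}
          = signed_trop A \<epsilon> (\<lambda>\<alpha>. if \<epsilon> \<alpha> = 1 then T else 0)"
        unfolding trop by auto
      moreover have "{x. log_ratio P N d x = 0} = zero_set (exp_sum A c)"
        using pos ne by (auto simp: zero_set_def split log_ratio_def)
      ultimately show ?thesis by auto
    next
      case False
      then have neg: "exp_sum A c x < 0" for x
        using smooth by (intro nonpositive_exp_sum_has_no_zero) (auto simp: not_less)
      then have "zero_set (exp_sum A c) = {}" by (auto simp: zero_set_def less_le)
      moreover have "signed_trop A \<epsilon> (\<lambda>\<alpha>. if \<epsilon> \<alpha> = 1 then 0 else 1) = {}"
      proof -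
        have "support_function P v \<le> support_function N v" for v
          using fin ne d_pos neg by (intro support_function_le_if_exp_sum_less) (auto simp: split)
        then have "support_function P v + 0 \<noteq> support_function N v + 1" for v
          by (smt (verit))
        then show ?thesis unfolding trop by blast
      qed
      ultimately have "same_isotopy_type (signed_trop A \<epsilon> (\<lambda>\<alpha>. if \<epsilon> \<alpha> = 1 then 0 else 1)) (zero_set (exp_sum A c))"
        by (simp only: same_isotopy_type_refl)
      then show ?thesis by blast
    qed
  qed
qed

theorem corollary4p14:
  fixes A :: "(real^'n) set" and \<epsilon> :: "real^'n \<Rightarrow> real"
  assumes "signed_support A \<epsilon>"
    and "full_dimensional A"
    and "has_codimension A 2"
    and "card (neg_part A \<epsilon>) = 1 \<or>
         (\<exists>P. int CARD('n) simplex P \<and>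
              pos_part A \<epsilon> \<subseteq> P \<and>
              neg_part A \<epsilon> \<subseteq> simplex_opposite P \<and>
              A \<inter> interior (P \<union> simplex_opposite P) \<noteq> {})"
    and "\<And>F. F face_of (convex hull A) \<Longrightarrow> F \<noteq> {} \<Longrightarrow> F \<noteq> convex hull A \<Longrightarrow>
           \<exists>v a. nontrivial_separating_hyperplane (A \<inter> F) \<epsilon> v a"
  shows "\<forall>c \<in> coeffs_with_signs A \<epsilon>. smooth_zero_set (exp_sum A c) \<longrightarrow>
           (\<exists>h :: real^'n \<Rightarrow> real.
              same_isotopy_type (signed_trop A \<epsilon> h) (zero_set (exp_sum A c)))"
proof (intro ballI impI)
  fix c assume c: "c \<in> coeffs_with_signs A \<epsilon>" and smooth: "smooth_zero_set (exp_sum A c)"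
  show "\<exists>h. same_isotopy_type (signed_trop A \<epsilon> h) (zero_set (exp_sum A c))"
    using assms(4)
  proof
    assume "\<exists>P. int CARD('n) simplex P \<and> pos_part A \<epsilon> \<subseteq> P \<and> neg_part A \<epsilon> \<subseteq> simplex_opposite P \<and>
              A \<inter> interior (P \<union> simplex_opposite P) \<noteq> {}"
    then have "exp_dominated (pos_part A \<epsilon>) (neg_part A \<epsilon>)" using exp_dominated_simplex by blast
    then show ?thesis
      using signed_trop_realizes_isotopy_type[OF assms(1,2) _ assms(5) c smooth] by blast
  next
    assume "card (neg_part A \<epsilon>) = 1"
    then obtain \<beta> where \<beta>: "neg_part A \<epsilon> = {\<beta>}" by (auto simp: card_1_singleton_iff)
    \<comment> \<open>With a single negative exponent the roles of the signs are exchanged: a singleton is dominated by every set.\<close>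
    define \<epsilon>' c' where "\<epsilon>' = (\<lambda>\<alpha>. - \<epsilon> \<alpha>)" and "c' = (\<lambda>\<alpha>. - c \<alpha>)"
    have parts: "pos_part B \<epsilon>' = neg_part B \<epsilon>" "neg_part B \<epsilon>' = pos_part B \<epsilon>" for B
      by (auto simp: \<epsilon>'_def pos_part_def neg_part_def)
    have f: "exp_sum A c' = (\<lambda>x. - exp_sum A c x)" by (simp add: c'_def exp_sum_def sum_negf fun_eq_iff)
    have "\<exists>h. same_isotopy_type (signed_trop A \<epsilon>' h) (zero_set (exp_sum A c'))"
    proof (rule signed_trop_realizes_isotopy_type)
      show "signed_support A \<epsilon>'" using assms(1) by (auto simp: signed_support_def \<epsilon>'_def)
      show "full_dimensional A" by fact
      show "exp_dominated (pos_part A \<epsilon>') (neg_part A \<epsilon>')" by (simp add: parts \<beta> exp_dominated_singleton)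
      show "c' \<in> coeffs_with_signs A \<epsilon>'" using c by (simp add: coeffs_with_signs_def c'_def \<epsilon>'_def sgn_minus)
      show "smooth_zero_set (exp_sum A c')"
      proof -
        have "((\<lambda>t. exp_sum A c (x + t *\<^sub>R axis i 1)) has_real_derivative 0) (at 0)"
          if "((\<lambda>t. - exp_sum A c (x + t *\<^sub>R axis i 1)) has_real_derivative 0) (at 0)" for x i
          using DERIV_minus[OF that] by simp
        then show ?thesis using smooth unfolding f smooth_zero_set_def neg_equal_0_iff_equal by blast
      qed
      show "\<exists>v a. nontrivial_separating_hyperplane (A \<inter> F) \<epsilon>' v a"
        if F: "F face_of convex hull A" "F \<noteq> {}" "F \<noteq> convex hull A" for F
      proof -
        obtain v a where "nontrivial_separating_hyperplane (A \<inter> F) \<epsilon> v a" using assms(5)[OF F] by blast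
        moreover have "halfspace_ge (- v) (- a) = halfspace_le v a" "halfspace_le (- v) (- a) = halfspace_ge v a"
          by (auto simp: halfspace_ge_def halfspace_le_def)
        ultimately have "nontrivial_separating_hyperplane (A \<inter> F) \<epsilon>' (- v) (- a)"
          by (auto simp: nontrivial_separating_hyperplane_def separating_hyperplane_def parts)
        then show ?thesis by blast
      qed
    qed
    moreover have "signed_trop A \<epsilon>' h = signed_trop A \<epsilon> h" for h
      by (auto simp: signed_trop_def parts)
    moreover have "zero_set (exp_sum A c') = zero_set (exp_sum A c)" by (simp add: f zero_set_def)
    ultimately show ?thesis by simp
  qed
qed

end
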